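(* Let $\mathcal{X},\mathcal{Y}$ be real Hilbert spaces, $f:\mathcal{X}\to\mathbb{R}$ a continuously differentiable convex function such that $\nabla f$ is Lipschitz continuous, $A:\mathcal{X}\to\mathcal{Y}$ a continuous linear operator, $b\in\mathcal{Y}$, $\theta>0$, $t_0>0$, $\sigma\ge0$, and suppose $\Omega\neq\emptyset$. Let $\epsilon:[t_0,+\infty)\to[0,+\infty)$ be a $\mathcal{C}^1$ non-increasing function and let $\gamma,\beta:[t_0,+\infty)\to[0,+\infty)$ be $\mathcal{C}^1$ functions such that for all $t\ge t_0$ $$(2\theta-1)\beta(t)+\theta t\dot\beta(t)\le 0,\qquad \gamma(t)+t\dot\gamma(t)\le t\beta(t)\epsilon(t),\qquad \theta t\gamma(t)-\theta-1\ge 0,$$ and such that $\int_{t_0}^{+\infty}\frac{\beta(t)\epsilon(t)}{t}\,dt<+\infty$, $\liminf_{t\to+\infty}\beta(t)\ne0$ and $\lim_{t\to+\infty}t^2\beta(t)\epsilon(t)=+\infty$. Let $(x(\cdot),\lambda(\cdot))$ be a global solution of $$\begin{cases}\ddot x(t)+\gamma(t)\dot x(t)+\beta(t)\big(\nabla f(x(t))+A^T\lambda(t)+\sigma A^T(Ax(t)-b)+\epsilon(t)x(t)\big)=0,\\ \dot\lambda(t)-t\beta(t)\big(A(x(t)+\theta t\dot x(t))-b\big)=0,\end{cases}\qquad t\ge t_0.$$ Let $S$ be the solution set of $\min_{x\in\mathcal{X}}f(x)$ subject to $Ax=b$, and let $\hat x^*=\mathrm{Proj}_S 0$ be the unique element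 of minimal norm in $S$. Then $$\liminf_{t\to+\infty}\|x(t)-\hat x^*\|=0.$$ Moreover, if there exists a large enough $T$ such that the trajectory $\{x(t):t\ge T\}$ stays in either the open ball $B(0,\|\hat x^*\|)$ or its complement, then $$\lim_{t\to+\infty}\|x(t)-\hat x^*\|=0.$$
   Context: $A^T:\mathcal{Y}\to\mathcal{X}$ denotes the adjoint of $A$. The augmented Lagrangian is $\mathcal{L}_\sigma(x,\lambda)=f(x)+\langle\lambda,Ax-b\rangle+\frac{\sigma}{2}\|Ax-b\|^2$ on $\mathcal{X}\times\mathcal{Y}$, with penalty parameter $\sigma\ge0$. $\Omega$ is the set of saddle points (primal-dual optimal solutions): $(x^*,\lambda^* )\in\Omega$ iff $\mathcal{L}_\sigma(x^*,\lambda)\le\mathcal{L}_\sigma(x^*,\lambda^* )\le\mathcal{L}_\sigma(x,\lambda^* )$ for all $(x,\lambda)\in\mathcal{X}\times\mathcal{Y}$. It is a standing assumption that the problem satisfies the Slater condition, so that $x^*$ is optimal with Lagrange multiplier $\lambda^*$ if and only if $(x^*,\lambda^* )\in\Omega$. A global solution is a pair $x:[t_0,+\infty)\to\mathcal{X}$ (twice differentiable), $\lambda:[t_0,+\infty)\to\mathcal{Y}$ (differentiable) satisfying the system for all $t\ge t_0$. $\mathrm{Proj}_S 0$ is the projection of the origin onto the closed convex set $S$. Dots denote derivatives in $t$. *)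

theory Defs
  imports "HOL-Analysis.Analysis"
begin

text \<open>
  Real Hilbert spaces are types of sort \<open>{real_inner, complete_space}\<close>.  The adjoint of a bounded
  linear operator is the library constant \<^const>\<open>adjoint\<close>; like \<open>gradient\<close> below, it is
  well defined by the Riesz representation theorem.
\<close>

definition gradient :: "('a::real_inner \<Rightarrow> real) \<Rightarrow> 'a \<Rightarrow> 'a" where
  "gradient f x = (THE D. GDERIV f x :> D)"

definition continuously_differentiable :: "('a::real_inner \<Rightarrow> real) \<Rightarrow> bool" where
  "continuously_differentiable f \<longleftrightarrow>
     (\<forall>x. f differentiable (at x)) \<and> continuous_on UNIV (gradient f)"

text \<open>
  The library's \<^const>\<open>closest_point\<close> is restricted to Heine-Borel spaces, which excludes
  infinite-dimensional Hilbert spaces.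
\<close>

definition Proj :: "'a::{real_inner, complete_space} set \<Rightarrow> 'a \<Rightarrow> 'a" where
  "Proj S a = (THE p. p \<in> S \<and> (\<forall>y\<in>S. dist a p \<le> dist a y))"

definition aug_lagrangian ::
  "('a::real_inner \<Rightarrow> real) \<Rightarrow> ('a \<Rightarrow> 'b::real_inner) \<Rightarrow> 'b \<Rightarrow> real \<Rightarrow> 'a \<Rightarrow> 'b \<Rightarrow> real" where
  "aug_lagrangian f A b \<sigma> x l = f x + l \<bullet> (A x - b) + \<sigma> / 2 * (norm (A x - b))\<^sup>2"

definition saddle_points ::
  "('a::real_inner \<Rightarrow> real) \<Rightarrow> ('a \<Rightarrow> 'b::real_inner) \<Rightarrow> 'b \<Rightarrow> real \<Rightarrow> ('a \<times> 'b) set" where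
  "saddle_points f A b \<sigma> =
     {(xs, ls). \<forall>x l. aug_lagrangian f A b \<sigma> xs l \<le> aug_lagrangian f A b \<sigma> xs ls \<and>
                      aug_lagrangian f A b \<sigma> xs ls \<le> aug_lagrangian f A b \<sigma> x ls}"

definition solution_set ::
  "('a::real_inner \<Rightarrow> real) \<Rightarrow> ('a \<Rightarrow> 'b::real_inner) \<Rightarrow> 'b \<Rightarrow> 'a set" where
  "solution_set f A b = {x. A x = b \<and> (\<forall>y. A y = b \<longrightarrow> f x \<le> f y)}"

text \<open>
  The objective is finite everywhere and the only constraints are affine equations, so the Slater
  condition (a feasible point in the relative interior of the domain) asks for a feasible point.
\<close>

definition slater_condition :: "('a::real_inner \<Rightarrow> 'b::real_inner) \<Rightarrow> 'b \<Rightarrow> bool" where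
  "slater_condition A b \<longleftrightarrow> (\<exists>x. A x = b)"

text \<open>
  Trajectories are total functions on the reals of which only the values on \<open>{t0..}\<close> matter;
  derivatives are taken within \<open>{t0..}\<close>, hence one-sided at \<open>t0\<close>, and are unique there.
\<close>

definition global_solution ::
  "('a::real_inner \<Rightarrow> real) \<Rightarrow> ('a \<Rightarrow> 'b::real_inner) \<Rightarrow> 'b \<Rightarrow> real \<Rightarrow> real \<Rightarrow> real \<Rightarrow>
   (real \<Rightarrow> real) \<Rightarrow> (real \<Rightarrow> real) \<Rightarrow> (real \<Rightarrow> real) \<Rightarrow> (real \<Rightarrow> 'a) \<Rightarrow> (real \<Rightarrow> 'b) \<Rightarrow> bool" where
  "global_solution f A b \<sigma> \<theta> t0 \<epsilon> \<gamma> \<beta> x l \<longleftrightarrow>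
     (\<exists>x' x'' l'. \<forall>t\<ge>t0.
        (x has_vector_derivative x' t) (at t within {t0..}) \<and>
        (x' has_vector_derivative x'' t) (at t within {t0..}) \<and>
        (l has_vector_derivative l' t) (at t within {t0..}) \<and>
        x'' t + \<gamma> t *\<^sub>R x' t
          + \<beta> t *\<^sub>R (gradient f (x t) + adjoint A (l t)
                      + \<sigma> *\<^sub>R adjoint A (A (x t) - b) + \<epsilon> t *\<^sub>R x t) = 0 \<and>
        l' t - (t * \<beta> t) *\<^sub>R (A (x t + (\<theta> * t) *\<^sub>R x' t) - b) = 0)"

definition C1_with_deriv :: "real \<Rightarrow> (real \<Rightarrow> real) \<Rightarrow> (real \<Rightarrow> real) \<Rightarrow> bool" where
  "C1_with_deriv t0 g g' \<longleftrightarrow>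
     (\<forall>t\<ge>t0. (g has_real_derivative g' t) (at t within {t0..})) \<and> continuous_on {t0..} g'"

end

theory Submission
  imports Defs
begin

text \<open>
  Let \<open>p\<close> be the minimal-norm solution and \<open>(p, ls)\<close> a saddle point.  The energy
  \<open>\<theta>\<^sup>2 t\<^sup>2 \<beta> (gap + \<epsilon>/2 (\<parallel>x\<parallel>\<^sup>2 - m)) + \<parallel>x - p + \<theta> t x'\<parallel>\<^sup>2/2 + (\<theta> t \<gamma> - \<theta> - 1)/2 \<parallel>x - p\<parallel>\<^sup>2
  + \<theta>/2 \<parallel>l - ls\<parallel>\<^sup>2\<close> has derivative at most \<open>\<theta> t \<beta> \<epsilon> (\<parallel>p\<parallel>\<^sup>2 - m)/2\<close> as long as \<open>m \<le> \<parallel>x\<parallel>\<^sup>2\<close>.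
  For \<open>m = 0\<close>, integrability of \<open>\<beta> \<epsilon> / t\<close> gives an energy of order \<open>o(t\<^sup>2)\<close>, so the
  Lagrangian gap tends to \<open>0\<close>, the multiplier grows at most linearly and \<open>A x - b\<close> tends to \<open>0\<close>.
  Hence whenever \<open>\<parallel>x\<parallel>\<close> does not exceed \<open>\<parallel>p\<parallel>\<close> by much at a late time, \<open>x\<close> is close to \<open>p\<close>.
  If the trajectory stays outside the ball of radius \<open>\<parallel>p\<parallel>\<close>, the choice \<open>m = \<parallel>p\<parallel>\<^sup>2\<close> makes the energy
  bounded, and \<open>\<parallel>x\<parallel>\<^sup>2 - \<parallel>p\<parallel>\<^sup>2 = O(1 / (t\<^sup>2 \<beta> \<epsilon>))\<close> tends to \<open>0\<close>; otherwise the trajectory enters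
  the ball at arbitrarily late times.
\<close>

section \<open>Minimal-norm points in Hilbert spaces\<close>

lemma norm_diff_sq_parallelogram:
  fixes x y :: "'a::real_inner"
  shows "(norm (x - y))\<^sup>2 = 2 * (norm x)\<^sup>2 + 2 * (norm y)\<^sup>2 - 4 * (norm ((1/2) *\<^sub>R (x + y)))\<^sup>2"
  by (simp add: power_mult_distrib dot_square_norm[symmetric] power2_norm_eq_inner algebra_simps inner_commute)

text \<open>The midpoint of \<open>x\<close> and \<open>y\<close> lies in \<open>C\<close>, so its
  norm is at least \<open>infdist 0 C\<close>; the parallelogram law turns this into a bound on the
  distance of two almost norm-minimal points.\<close>

lemma convex_dist_sq_le:
  fixes x y :: "'a::real_inner"
  assumes "convex C" "x \<in> C" "y \<in> C"
  shows "(norm (x - y))\<^sup>2 \<le> 2 * (norm x)\<^sup>2 + 2 * (norm y)\<^sup>2 - 4 * (infdist 0 C)\<^sup>2"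
proof -
  have "(1/2) *\<^sub>R (x + y) \<in> C"
    using convexD[OF assms, of "1/2" "1/2"] by (simp add: scaleR_add_right)
  then have "infdist 0 C \<le> norm ((1/2) *\<^sub>R (x + y))"
    using infdist_le[of _ C 0] by fastforce
  then have "(infdist 0 C)\<^sup>2 \<le> (norm ((1/2) *\<^sub>R (x + y)))\<^sup>2"
    by (intro power_mono infdist_nonneg)
  then show ?thesis
    by (simp add: norm_diff_sq_parallelogram)
qed

text \<open>The distances \<open>infdist 0 (C n)\<close> increase and are bounded, so almost
  norm-minimal points of the \<open>C n\<close> form a Cauchy sequence: for \<open>m < n\<close> the
  points with indices \<open>m\<close> and \<open>n\<close> both lie in \<open>C m\<close>. Their
  limit is the required \<open>p\<close>.\<close>

lemma nested_convex_infdist_tendsto: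
  fixes C :: "nat \<Rightarrow> 'a::{real_inner, complete_space} set"
  assumes closed: "\<And>n. closed (C n)" and conv: "\<And>n. convex (C n)"
    and nonempty: "\<And>n. C n \<noteq> {}" and dec: "decseq C"
    and bdd: "\<And>n. infdist 0 (C n) \<le> R"
  obtains p where "\<And>n. p \<in> C n" "(\<lambda>n. infdist 0 (C n)) \<longlonglongrightarrow> norm p"
proof -
  define d where "d n = infdist 0 (C n)" for n
  have "incseq d"
    unfolding d_def incseq_def using dec nonempty by (auto simp: decseq_def intro!: infdist_mono)
  then obtain D where D: "d \<longlonglongrightarrow> D"
    using incseq_convergent[OF \<open>incseq d\<close>, of R] bdd unfolding d_def by blast
  define a where "a n = d n + 1 / real (Suc n)" for n
  have "a \<longlonglongrightarrow> D + 0"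
    unfolding a_def using LIMSEQ_inverse_real_of_nat
    by (intro tendsto_add D) (simp add: inverse_eq_divide)
  then have a: "a \<longlonglongrightarrow> D" by simp
  have "\<exists>y\<in>C n. norm y < a n" for n
  proof (rule ccontr)
    assume "\<not> ?thesis"
    then have "a n \<le> infdist 0 (C n)"
      using nonempty[of n] by (auto simp: infdist_notempty not_less intro!: cINF_greatest)
    then show False
      by (simp add: a_def d_def)
  qed
  then obtain y where yC: "\<And>n. y n \<in> C n" and y: "\<And>n. norm (y n) < a n"
    by metis
  have yC': "y k \<in> C n" if "n \<le> k" for n k
    using dec yC that by (auto simp: decseq_def)
  have d_le: "d n \<le> norm (y n)" for n
    using infdist_le[OF yC[of n], of 0] by (simp add: d_def)
  have "Cauchy y"
  proof (rule CauchyI')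
    fix e :: real assume e: "e > 0"
    \<comment> \<open>The final estimate has coefficients 2, 2 and 4 in front of squares known up to
      this tolerance, and the errors add up to \<open>e\<^sup>2\<close>.\<close>
    then have e2: "e\<^sup>2 / 8 > 0" by simp
    have "(\<lambda>n. (a n)\<^sup>2) \<longlonglongrightarrow> D\<^sup>2" "(\<lambda>n. (d n)\<^sup>2) \<longlonglongrightarrow> D\<^sup>2"
      by (intro tendsto_power a D)+
    then have "\<forall>\<^sub>F n in sequentially. \<bar>(a n)\<^sup>2 - D\<^sup>2\<bar> < e\<^sup>2 / 8 \<and> \<bar>(d n)\<^sup>2 - D\<^sup>2\<bar> < e\<^sup>2 / 8"
      using tendstoD[OF _ e2] by (intro eventually_conj) (force simp: dist_real_def)+
    then obtain N where N: "\<And>n. n \<ge> N \<Longrightarrow> \<bar>(a n)\<^sup>2 - D\<^sup>2\<bar> < e\<^sup>2 / 8"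
      "\<And>n. n \<ge> N \<Longrightarrow> \<bar>(d n)\<^sup>2 - D\<^sup>2\<bar> < e\<^sup>2 / 8"
      unfolding eventually_sequentially by blast
    show "\<exists>M. \<forall>m\<ge>M. \<forall>n>m. dist (y m) (y n) < e"
    proof (intro exI[of _ N] allI impI)
      fix m n assume mn: "N \<le> m" "m < n"
      have "(norm (y m - y n))\<^sup>2 \<le> 2 * (norm (y m))\<^sup>2 + 2 * (norm (y n))\<^sup>2 - 4 * (d m)\<^sup>2"
        unfolding d_def using mn yC' by (intro convex_dist_sq_le conv) auto
      also have "\<dots> \<le> 2 * (a m)\<^sup>2 + 2 * (a n)\<^sup>2 - 4 * (d m)\<^sup>2"
        using y by (intro diff_right_mono add_mono mult_left_mono power_mono) (auto intro: less_imp_le)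
      also have "\<dots> < e\<^sup>2"
        using N(1)[of m] N(1)[of n] N(2)[of m] mn by linarith
      finally show "dist (y m) (y n) < e"
        using e by (simp add: dist_norm power_less_imp_less_base)
    qed
  qed
  then obtain p where p: "y \<longlonglongrightarrow> p"
    using Cauchy_convergent convergent_def by blast
  have "p \<in> C n" for n
    using Lim_in_closed_set[OF closed _ trivial_limit_sequentially p, of n]
      yC' eventually_sequentially by blast
  moreover have "(\<lambda>n. norm (y n)) \<longlonglongrightarrow> D"
    by (rule tendsto_sandwich[OF _ _ D a]) (auto intro!: always_eventually d_le less_imp_le y)
  then have "norm p = D"
    using tendsto_norm[OF p] LIMSEQ_unique by blast
  ultimately show ?thesis
    using that D unfolding d_def by blast
qed

text \<open>Apply the distance bound to \<open>y n\<close> and \<open>p\<close>, both in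
  \<open>C n\<close>: its right-hand side tends to \<open>0\<close>, since \<open>r n\<close> and
  \<open>infdist 0 (C n)\<close> both tend to \<open>norm p\<close>.\<close>

lemma nested_convex_tendsto:
  fixes C :: "nat \<Rightarrow> 'a::real_inner set"
  assumes conv: "\<And>n. convex (C n)" and p: "\<And>n. p \<in> C n"
    and lim: "(\<lambda>n. infdist 0 (C n)) \<longlonglongrightarrow> norm p"
    and y: "\<And>n. y n \<in> C n" "\<And>n. norm (y n) \<le> r n" and r: "r \<longlonglongrightarrow> norm p"
  shows "y \<longlonglongrightarrow> p"
proof -
  have "(\<lambda>n. 2 * (r n)\<^sup>2 + 2 * (norm p)\<^sup>2 - 4 * (infdist 0 (C n))\<^sup>2)
      \<longlonglongrightarrow> 2 * (norm p)\<^sup>2 + 2 * (norm p)\<^sup>2 - 4 * (norm p)\<^sup>2"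
    by (intro tendsto_intros r lim)
  then have b: "(\<lambda>n. 2 * (r n)\<^sup>2 + 2 * (norm p)\<^sup>2 - 4 * (infdist 0 (C n))\<^sup>2) \<longlonglongrightarrow> 0"
    by simp
  have "(norm (y n - p))\<^sup>2 \<le> 2 * (r n)\<^sup>2 + 2 * (norm p)\<^sup>2 - 4 * (infdist 0 (C n))\<^sup>2" for n
  proof -
    have "(norm (y n))\<^sup>2 \<le> (r n)\<^sup>2"
      using y by (intro power_mono) auto
    then show ?thesis
      using convex_dist_sq_le[OF conv y(1) p, of n] by linarith
  qed
  then have "(\<lambda>n. (norm (y n - p))\<^sup>2) \<longlonglongrightarrow> 0"
    by (intro tendsto_sandwich[OF _ _ tendsto_const b]) auto
  then have "(\<lambda>n. norm (y n - p)) \<longlonglongrightarrow> 0"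
    using tendsto_real_sqrt[of "\<lambda>n. (norm (y n - p))\<^sup>2" 0] by simp
  then show ?thesis
    using LIM_zero_iff tendsto_norm_zero_iff by blast
qed

text \<open>Constant sequences of sets in the two preceding lemmas: the first gives existence, the
  second, applied to the constant sequence \<open>q\<close>, uniqueness.\<close>

lemma closed_convex_min_norm:
  fixes S :: "'a::{real_inner, complete_space} set"
  assumes "closed S" "convex S" "S \<noteq> {}"
  obtains p where "p \<in> S" "\<And>y. y \<in> S \<Longrightarrow> norm p \<le> norm y"
    "\<And>q. q \<in> S \<Longrightarrow> norm q \<le> norm p \<Longrightarrow> q = p"
proof -
  obtain p where p: "p \<in> S" "(\<lambda>n::nat. infdist 0 S) \<longlonglongrightarrow> norm p"
    using nested_convex_infdist_tendsto[of "\<lambda>_. S" "infdist 0 S"] assms by auto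
  then have eq: "infdist 0 S = norm p"
    using LIMSEQ_const_iff by blast
  show ?thesis
  proof
    show "norm p \<le> norm y" if "y \<in> S" for y
      using infdist_le[OF that, of 0] eq by simp
    show "q = p" if "q \<in> S" "norm q \<le> norm p" for q
      using nested_convex_tendsto[of "\<lambda>_. S" p "\<lambda>_. q" "\<lambda>_. norm p"] assms p that
      by (simp add: LIMSEQ_const_iff)
  qed (use p in auto)
qed

lemma Proj_zero:
  fixes S :: "'a::{real_inner, complete_space} set"
  assumes "closed S" "convex S" "S \<noteq> {}"
  shows "Proj S 0 \<in> S" "\<And>y. y \<in> S \<Longrightarrow> norm (Proj S 0) \<le> norm y"
    "\<And>q. q \<in> S \<Longrightarrow> norm q \<le> norm (Proj S 0) \<Longrightarrow> q = Proj S 0"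
proof -
  obtain p where p: "p \<in> S" "\<And>y. y \<in> S \<Longrightarrow> norm p \<le> norm y"
    "\<And>q. q \<in> S \<Longrightarrow> norm q \<le> norm p \<Longrightarrow> q = p"
    using closed_convex_min_norm[OF assms] by blast
  have "Proj S 0 = p"
    unfolding Proj_def using p by (intro the_equality) auto
  then show "Proj S 0 \<in> S" "\<And>y. y \<in> S \<Longrightarrow> norm (Proj S 0) \<le> norm y"
    "\<And>q. q \<in> S \<Longrightarrow> norm q \<le> norm (Proj S 0) \<Longrightarrow> q = Proj S 0"
    using p by auto
qed

section \<open>Riesz representation, adjoint and gradient\<close>

text \<open>The minimal-norm point \<open>p\<close> of the hyperplane \<open>\<phi> x = 1\<close> is
  orthogonal to the kernel of \<open>\<phi>\<close>, and \<open>x - \<phi> x *\<^sub>R p\<close>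
  lies in that kernel; rescaling \<open>p\<close> gives the representing vector.\<close>

lemma riesz_representation:
  fixes \<phi> :: "'a::{real_inner, complete_space} \<Rightarrow> real"
  assumes "bounded_linear \<phi>"
  shows "\<exists>v. \<forall>x. \<phi> x = x \<bullet> v"
proof (cases "\<forall>x. \<phi> x = 0")
  case True
  then show ?thesis by (intro exI[of _ 0]) simp
next
  case False
  interpret bounded_linear \<phi> by fact
  obtain x0 where x0: "\<phi> x0 \<noteq> 0" using False by blast
  define S where "S = {x. \<phi> x = 1}"
  have "closed S"
    unfolding S_def by (intro closed_Collect_eq continuous_intros linear_continuous_on assms)
  moreover have "convex S"
    unfolding S_def convex_def by (auto simp: add scale)
  moreover have "(1 / \<phi> x0) *\<^sub>R x0 \<in> S"
    using x0 by (simp add: S_def scale)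
  ultimately obtain p where p: "p \<in> S" "\<And>y. y \<in> S \<Longrightarrow> norm p \<le> norm y"
    using closed_convex_min_norm[of S] by (metis empty_iff)
  have orth: "p \<bullet> z = 0" if z: "\<phi> z = 0" for z
  proof (rule ccontr)
    assume nz: "p \<bullet> z \<noteq> 0"
    then have zz: "z \<bullet> z > 0" by auto
    \<comment> \<open>This \<open>c\<close> minimises the norm of \<open>p + c *\<^sub>R z\<close>,
      and the minimum is strictly below \<open>norm p\<close> unless \<open>p\<close> and
      \<open>z\<close> are orthogonal.\<close>
    define c where "c = - (p \<bullet> z) / (z \<bullet> z)"
    have "p + c *\<^sub>R z \<in> S"
      using p z by (simp add: S_def add scale)
    then have "(norm p)\<^sup>2 \<le> (norm (p + c *\<^sub>R z))\<^sup>2"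
      using p by (intro power_mono) auto
    also have "\<dots> = (norm p)\<^sup>2 + 2 * c * (p \<bullet> z) + c\<^sup>2 * (z \<bullet> z)"
      unfolding power2_norm_eq_inner
      by (simp add: inner_add inner_commute algebra_simps power2_eq_square)
    also have "\<dots> = (norm p)\<^sup>2 - (p \<bullet> z)\<^sup>2 / (z \<bullet> z)"
      using zz by (simp add: c_def field_simps power2_eq_square)
    finally show False
      using nz zz by (simp add: field_simps)
  qed
  have "\<phi> x = x \<bullet> ((1 / (p \<bullet> p)) *\<^sub>R p)" for x
  proof -
    have "\<phi> (x - \<phi> x *\<^sub>R p) = 0"
      using p by (simp add: diff scale S_def)
    then have "p \<bullet> x = \<phi> x * (p \<bullet> p)"
      using orth[of "x - \<phi> x *\<^sub>R p"] by (simp add: inner_diff)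
    moreover have "p \<noteq> 0"
      using p(1) zero by (auto simp: S_def)
    ultimately show ?thesis
      by (simp add: inner_commute)
  qed
  then show ?thesis by blast
qed

text \<open>\<open>adjoint\<close> is a Hilbert choice, so its characteristic identity rests on the
  existence that Riesz representation supplies.\<close>

lemma inner_adjoint:
  fixes A :: "'a::{real_inner, complete_space} \<Rightarrow> 'b::real_inner"
  assumes "bounded_linear A"
  shows "x \<bullet> adjoint A y = A x \<bullet> y"
proof -
  have "bounded_linear (\<lambda>x. A x \<bullet> y)" for y
    by (rule bounded_linear_inner_left_comp[OF assms])
  then have "\<exists>v. \<forall>x. A x \<bullet> y = x \<bullet> v" for y
    by (rule riesz_representation)
  then have "\<exists>A'. \<forall>x y. A x \<bullet> y = x \<bullet> A' y"
    by metis
  then show ?thesis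
    unfolding adjoint_def by (rule someI2_ex) auto
qed

text \<open>Riesz representation turns the derivative into a vector, and uniqueness of derivatives
  makes the definite description denote it.\<close>

lemma GDERIV_gradient:
  fixes f :: "'a::{real_inner, complete_space} \<Rightarrow> real"
  assumes "f differentiable (at x)"
  shows "GDERIV f x :> gradient f x"
proof -
  obtain f' where f': "(f has_derivative f') (at x)"
    using assms by (auto simp: differentiable_def)
  then obtain v where "\<forall>h. f' h = h \<bullet> v"
    using riesz_representation has_derivative_bounded_linear by blast
  then have "f' = (\<lambda>h. h \<bullet> v)"
    by auto
  then have v: "GDERIV f x :> v"
    using f' by (simp add: gderiv_def)
  have "D = v" if "GDERIV f x :> D" for D
    using has_derivative_unique[OF that[unfolded gderiv_def] v[unfolded gderiv_def]]
    by (metis inner_commute vector_eq_ldot)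
  then show ?thesis
    unfolding gradient_def using v by (metis the_equality)
qed

text \<open>Along the line through \<open>x\<close> and \<open>y\<close> this is the tangent
  inequality for a convex function of one real variable, between the parameters 0 and 1.\<close>

lemma convex_gradient_inequality:
  fixes f :: "'a::{real_inner, complete_space} \<Rightarrow> real"
  assumes conv: "convex_on UNIV f" and diff: "f differentiable (at x)"
  shows "gradient f x \<bullet> (y - x) \<le> f y - f x"
proof -
  define g where "g s = f (x + s *\<^sub>R (y - x))" for s :: real
  have "convex_on UNIV g"
  proof (intro convex_onI)
    fix t u v :: real assume t: "0 < t" "t < 1"
    have "x + ((1 - t) *\<^sub>R u + t *\<^sub>R v) *\<^sub>R (y - x)
        = (1 - t) *\<^sub>R (x + u *\<^sub>R (y - x)) + t *\<^sub>R (x + v *\<^sub>R (y - x))"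
      by (simp add: algebra_simps)
    then show "g ((1 - t) *\<^sub>R u + t *\<^sub>R v) \<le> (1 - t) * g u + t * g v"
      unfolding g_def using convex_onD[OF conv, of t "x + u *\<^sub>R (y - x)" "x + v *\<^sub>R (y - x)"] t
      by simp
  qed simp
  moreover have "(g has_real_derivative gradient f x \<bullet> (y - x)) (at 0)"
  proof -
    have "(f has_derivative (\<lambda>h. h \<bullet> gradient f x)) (at (x + 0 *\<^sub>R (y - x)))"
      using GDERIV_gradient[OF diff] by (simp add: gderiv_def)
    then have "(g has_derivative (\<lambda>s. (s *\<^sub>R (y - x)) \<bullet> gradient f x)) (at 0)"
      unfolding g_def
      by (rule has_derivative_compose[rotated]) (auto intro!: derivative_eq_intros)
    then show ?thesis
      by (simp add: has_field_derivative_def inner_commute mult.commute[of _ "_ \<bullet> _"])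
  qed
  ultimately have "gradient f x \<bullet> (y - x) * (1 - 0) \<le> g 1 - g 0"
    by (intro convex_on_imp_above_tangent[of UNIV]) auto
  then show ?thesis by (simp add: g_def)
qed

section \<open>Sublevel sets and the solution set\<close>

lemma convex_on_sublevel:
  fixes f :: "'a::real_vector \<Rightarrow> real"
  assumes "convex_on UNIV f"
  shows "convex {z. f z \<le> s}"
proof (rule convexI)
  fix x y and u v :: real
  assume h: "x \<in> {z. f z \<le> s}" "y \<in> {z. f z \<le> s}" "0 \<le> u" "0 \<le> v" "u + v = 1"
  then have "f (u *\<^sub>R x + v *\<^sub>R y) \<le> u * f x + v * f y"
    using assms by (simp add: convex_on_def)
  also have "\<dots> \<le> s"
    using h by (intro convex_bound_le) auto
  finally show "u *\<^sub>R x + v *\<^sub>R y \<in> {z. f z \<le> s}" by simp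
qed

lemma sublevel_closed_convex:
  fixes f :: "'a::real_inner \<Rightarrow> real"
  assumes conv: "convex_on UNIV f" and cont: "continuous_on UNIV f" and A: "bounded_linear A"
  shows "closed {z. norm (A z - b) \<le> r \<and> f z \<le> s}" "convex {z. norm (A z - b) \<le> r \<and> f z \<le> s}"
proof -
  interpret bounded_linear A by fact
  show "closed {z. norm (A z - b) \<le> r \<and> f z \<le> s}"
    by (intro closed_Collect_conj closed_Collect_le continuous_intros linear_continuous_on A cont)
  have "{z. norm (A z - b) \<le> r \<and> f z \<le> s} = A -` cball b r \<inter> {z \<in> UNIV. f z \<le> s}"
    by (auto simp: dist_norm norm_minus_commute)
  also have "convex \<dots>"
  proof (intro convex_Int convex_linear_vimage linear_axioms convex_cball)
    show "convex {z \<in> UNIV. f z \<le> s}"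
      using convex_on_sublevel[OF conv] by simp
  qed
  finally show "convex {z. norm (A z - b) \<le> r \<and> f z \<le> s}" .
qed

text \<open>With both tolerances zero the sublevel set is the solution set, which is therefore
  closed and convex by \<open>sublevel_closed_convex\<close>.\<close>

lemma solution_set_eq_sublevel:
  assumes "p \<in> solution_set f A b"
  shows "solution_set f A b = {z. norm (A z - b) \<le> 0 \<and> f z \<le> f p}"
  using assms by (force simp: solution_set_def intro: order_trans)

text \<open>
  Strong convergence without weak compactness: by the parallelogram law, minimal-norm points of the
  shrinking sublevel sets converge to the minimal-norm point of their intersection.
\<close>

lemma near_solution_imp_near_Proj:
  fixes f :: "'a::{real_inner, complete_space} \<Rightarrow> real"
  assumes conv: "convex_on UNIV f" and cont: "continuous_on UNIV f" and A: "bounded_linear A"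
    and nonempty: "solution_set f A b \<noteq> {}" and p: "p = Proj (solution_set f A b) 0"
    and "\<eta> > 0"
  shows "\<exists>\<delta>>0. \<forall>z. norm (A z - b) \<le> \<delta> \<longrightarrow> f z \<le> f p + \<delta> \<longrightarrow> norm z \<le> norm p + \<delta>
    \<longrightarrow> norm (z - p) < \<eta>"
proof -
  define S where "S = solution_set f A b"
  \<comment> \<open>Relaxed solution sets, decreasing with intersection \<open>S\<close>.\<close>
  define C where "C n = {z. norm (A z - b) \<le> 1 / real (Suc n) \<and> f z \<le> f p + 1 / real (Suc n)}" for n
  obtain q where q: "q \<in> S" using nonempty by (auto simp: S_def)
  have cc: "closed S" "convex S"
    using solution_set_eq_sublevel[of q f A b] sublevel_closed_convex[OF conv cont A] q
    unfolding S_def by metis+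
  have pS: "p \<in> S" and pu: "\<And>q. q \<in> S \<Longrightarrow> norm q \<le> norm p \<Longrightarrow> q = p"
    using Proj_zero[OF cc] q unfolding p S_def by blast+
  have S_eq: "S = {z. norm (A z - b) \<le> 0 \<and> f z \<le> f p}"
    using pS unfolding S_def by (rule solution_set_eq_sublevel)
  have C: "closed (C n)" "convex (C n)" for n
    unfolding C_def by (rule sublevel_closed_convex[OF conv cont A])+
  have pC: "p \<in> C n" for n
    using pS unfolding S_eq C_def by simp
  have "decseq C"
    unfolding C_def decseq_def
    by (auto intro: order_trans[OF _ frac_le[of 1 1]] order_trans[OF _ add_left_mono[OF frac_le[of 1 1]]])
  moreover have "infdist 0 (C n) \<le> norm p" for n
    using infdist_le[OF pC[of n], of 0] by simp
  ultimately obtain q where q: "\<And>n. q \<in> C n" "(\<lambda>n. infdist 0 (C n)) \<longlonglongrightarrow> norm q"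
    using nested_convex_infdist_tendsto[of C "norm p"] C pC by (metis empty_iff)
  have lim0: "(\<lambda>n. 1 / real (Suc n)) \<longlonglongrightarrow> 0"
    using LIMSEQ_inverse_real_of_nat by (simp add: inverse_eq_divide)
  \<comment> \<open>The inequalities defining \<open>C n\<close> pass to the limit, so
    \<open>q\<close> is a solution of norm at most \<open>norm p\<close>, hence
    \<open>q = p\<close>.\<close>
  have "norm (A q - b) \<le> 0"
    using q(1) by (intro LIMSEQ_le_const[OF lim0]) (auto simp: C_def)
  moreover have "f q \<le> f p + 0"
    using q(1) by (intro LIMSEQ_le_const[OF tendsto_add[OF tendsto_const lim0]]) (auto simp: C_def)
  ultimately have "q \<in> S"
    by (simp add: S_eq)
  moreover have "norm q \<le> norm p"
    using \<open>\<And>n. infdist 0 (C n) \<le> norm p\<close> by (intro LIMSEQ_le_const2[OF q(2)]) auto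
  ultimately have lim: "(\<lambda>n. infdist 0 (C n)) \<longlonglongrightarrow> norm p"
    using pu q(2) by auto
  show ?thesis
  proof (rule ccontr)
    assume "\<not> ?thesis"
    \<comment> \<open>If no \<open>\<delta>\<close> works, the choices
      \<open>1 / real (Suc n)\<close> yield points that must converge to \<open>p\<close> and yet
      keep distance \<open>\<eta>\<close> from it.\<close>
    then have "\<exists>z. z \<in> C n \<and> norm z \<le> norm p + 1 / real (Suc n) \<and> norm (z - p) \<ge> \<eta>" for n
      by (drule_tac not_ex[THEN iffD1], drule_tac x="1 / real (Suc n)" in spec) (auto simp: C_def not_less)
    then obtain y where y: "\<And>n. y n \<in> C n" "\<And>n. norm (y n) \<le> norm p + 1 / real (Suc n)"
      "\<And>n. norm (y n - p) \<ge> \<eta>"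
      by metis
    have "(\<lambda>n. norm p + 1 / real (Suc n)) \<longlonglongrightarrow> norm p"
      using tendsto_add[OF tendsto_const lim0, of "norm p"] by simp
    then have "y \<longlonglongrightarrow> p"
      by (rule nested_convex_tendsto[OF C(2) pC lim y(1,2)])
    then have "(\<lambda>n. norm (y n - p)) \<longlonglongrightarrow> 0"
      by (simp add: LIM_zero_iff tendsto_norm_zero_iff)
    then have "\<eta> \<le> 0"
      using y(3) by (intro LIMSEQ_le_const) auto
    then show False using \<open>\<eta> > 0\<close> by simp
  qed
qed

section \<open>Real-variable estimates\<close>

lemma has_real_derivative_nonpos_imp_le:
  fixes g :: "real \<Rightarrow> real"
  assumes "\<And>t. t \<ge> T \<Longrightarrow> \<exists>D. (g has_real_derivative D) (at t within {T..}) \<and> D \<le> 0" "T \<le> s"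
  shows "g s \<le> g T"
proof (rule DERIV_nonpos_imp_decreasing_open[OF \<open>T \<le> s\<close>])
  show "\<exists>D. (g has_real_derivative D) (at t) \<and> D \<le> 0" if "T < t" "t < s" for t
    using assms(1)[of t] that at_within_interior[of t "{T..}"] by simp
  have "continuous_on {T..} g"
    unfolding continuous_on_eq_continuous_within
    using assms(1) by (auto intro: DERIV_continuous)
  then show "continuous_on {T..s} g"
    by (rule continuous_on_subset) auto
qed

text \<open>A positive derivative would force a strict increase just to the right of
  \<open>t\<close>, also at the end point \<open>t = a\<close>.\<close>

lemma antimono_imp_deriv_nonpos:
  fixes g :: "real \<Rightarrow> real"
  assumes mono: "antimono_on {a..} g" and t: "t \<ge> a" and d: "(g has_real_derivative D) (at t within {a..})"
  shows "D \<le> 0"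
proof (rule ccontr)
  assume "\<not> D \<le> 0"
  then obtain d where d: "d > 0" "\<And>h. h > 0 \<Longrightarrow> t + h \<in> {a..} \<Longrightarrow> h < d \<Longrightarrow> g t < g (t + h)"
    using has_real_derivative_pos_inc_right[OF d] by auto
  then have "g t < g (t + d / 2)"
    using t by simp
  moreover have "g (t + d / 2) \<le> g t"
    using monotone_onD[OF mono, of t "t + d / 2"] t d(1) by simp
  ultimately show False by simp
qed

text \<open>Recasts integrability as a bounded primitive, the form in which it can be combined with
  the derivative of the energy.\<close>

lemma bounded_primitive:
  fixes g :: "real \<Rightarrow> real"
  assumes cont: "continuous_on {a..} g" and nonneg: "\<And>t. t \<ge> a \<Longrightarrow> g t \<ge> 0"
    and int: "g integrable_on {a..}"
  obtains K R where "\<And>t. t \<ge> a \<Longrightarrow> (K has_real_derivative g t) (at t within {a..})"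
    "\<And>t. t \<ge> a \<Longrightarrow> K t \<le> R"
proof
  fix t :: real assume t: "t \<ge> a"
  have c: "continuous_on {a..s} g" for s
    using cont by (rule continuous_on_subset) auto
  have "((\<lambda>s. integral {a..s} g) has_real_derivative g t) (at t within {a..t + 1})"
    using t by (intro integral_has_real_derivative c) auto
  \<comment> \<open>Ending the compact interval at \<open>t + 1\<close> keeps \<open>t\<close> away
    from its right end, so both sets induce the same filter at \<open>t\<close>.\<close>
  moreover have "at t within {a..t + 1} = at t within {a..}"
    by (rule at_within_nhd[of _ "{..<t + 1}"]) auto
  ultimately show "((\<lambda>s. integral {a..s} g) has_real_derivative g t) (at t within {a..})"
    by simp
  show "integral {a..t} g \<le> integral {a..} g"
    using nonneg by (intro integral_subset_le integrable_continuous_real c int) auto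
qed

lemma has_real_derivative_within_tail:
  fixes g :: "real \<Rightarrow> real"
  assumes "(g has_real_derivative D) (at t within {a..})" "a \<le> T"
  shows "(g has_real_derivative D) (at t within {T..})"
  using assms by (auto intro: DERIV_subset)

lemma has_real_derivative_inner:
  fixes u v :: "real \<Rightarrow> 'c::real_inner"
  assumes "(u has_vector_derivative u') (at t within S)" "(v has_vector_derivative v') (at t within S)"
  shows "((\<lambda>t. u t \<bullet> v t) has_real_derivative u' \<bullet> v t + u t \<bullet> v') (at t within S)"
  using bounded_bilinear.has_vector_derivative[OF bounded_bilinear_inner assms]
  by (simp add: has_real_derivative_iff_has_vector_derivative add.commute)

lemma Liminf_eq_0I:
  fixes g :: "'a \<Rightarrow> real"
  assumes "\<And>t. g t \<ge> 0" "\<And>e. e > 0 \<Longrightarrow> \<exists>\<^sub>F t in F. g t < e"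
  shows "Liminf F (\<lambda>t. ereal (g t)) = 0"
proof (rule antisym)
  show "0 \<le> Liminf F (\<lambda>t. ereal (g t))"
    using assms(1) by (intro Liminf_bounded) auto
  show "Liminf F (\<lambda>t. ereal (g t)) \<le> 0"
  proof (rule ccontr)
    assume "\<not> ?thesis"
    then obtain e where "0 < ereal e" "ereal e < Liminf F (\<lambda>t. ereal (g t))"
      using ereal_dense2[of 0] by (auto simp: not_le)
    then have "\<forall>\<^sub>F t in F. g t > e" and "e > 0"
      using less_LiminfD by fastforce+
    then have "\<not> (\<exists>\<^sub>F t in F. g t < e)"
      by (auto simp: frequently_def elim: eventually_mono)
    then show False using assms(2) \<open>e > 0\<close> by blast
  qed
qed

section \<open>The energy of the flow\<close>

text \<open>The last two assumptions encode a saddle point \<open>(p, ls)\<close>: feasibility of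
  \<open>p\<close> is optimality in the multiplier, \<open>saddle\<close> is optimality in the
  primal variable. Minimality of \<open>norm p\<close> is added in
  \<open>tikhonov_flow\<close>.\<close>

locale primal_dual_flow =
  fixes f :: "'a::{real_inner, complete_space} \<Rightarrow> real"
    and A :: "'a \<Rightarrow> 'b::{real_inner, complete_space}"
    and b :: 'b
    and \<theta> t0 \<sigma> :: real
    and \<epsilon> \<gamma> \<beta> \<epsilon>' \<gamma>' \<beta>' :: "real \<Rightarrow> real"
    and x x' x'' :: "real \<Rightarrow> 'a"
    and l l' :: "real \<Rightarrow> 'b"
    and p :: 'a and ls :: 'b
  assumes conv: "convex_on UNIV f" and diff: "\<And>z. f differentiable (at z)"
    and A: "bounded_linear A"
    and \<theta>: "\<theta> > 0" and t0: "t0 > 0" and \<sigma>: "\<sigma> \<ge> 0"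
    and d\<epsilon>: "\<And>t. t \<ge> t0 \<Longrightarrow> (\<epsilon> has_real_derivative \<epsilon>' t) (at t within {t0..})"
    and d\<gamma>: "\<And>t. t \<ge> t0 \<Longrightarrow> (\<gamma> has_real_derivative \<gamma>' t) (at t within {t0..})"
    and d\<beta>: "\<And>t. t \<ge> t0 \<Longrightarrow> (\<beta> has_real_derivative \<beta>' t) (at t within {t0..})"
    and dx: "\<And>t. t \<ge> t0 \<Longrightarrow> (x has_vector_derivative x' t) (at t within {t0..})"
    and dx': "\<And>t. t \<ge> t0 \<Longrightarrow> (x' has_vector_derivative x'' t) (at t within {t0..})"
    and dl: "\<And>t. t \<ge> t0 \<Longrightarrow> (l has_vector_derivative l' t) (at t within {t0..})"
    and x''_eq: "\<And>t. t \<ge> t0 \<Longrightarrow> x'' t = - (\<gamma> t *\<^sub>R x' t) - \<beta> t *\<^sub>R (gradient f (x t)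
      + adjoint A (l t) + \<sigma> *\<^sub>R adjoint A (A (x t) - b) + \<epsilon> t *\<^sub>R x t)"
    and l'_eq: "\<And>t. t \<ge> t0 \<Longrightarrow> l' t = (t * \<beta> t) *\<^sub>R (A (x t + (\<theta> * t) *\<^sub>R x' t) - b)"
    and \<epsilon>: "\<And>t. t \<ge> t0 \<Longrightarrow> \<epsilon> t \<ge> 0" "\<And>t. t \<ge> t0 \<Longrightarrow> \<epsilon>' t \<le> 0"
    and \<beta>: "\<And>t. t \<ge> t0 \<Longrightarrow> \<beta> t \<ge> 0"
    and cond_\<beta>: "\<And>t. t \<ge> t0 \<Longrightarrow> (2 * \<theta> - 1) * \<beta> t + \<theta> * t * \<beta>' t \<le> 0"
    and cond_\<gamma>: "\<And>t. t \<ge> t0 \<Longrightarrow> \<gamma> t + t * \<gamma>' t \<le> t * \<beta> t * \<epsilon> t"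
    and cond_\<theta>: "\<And>t. t \<ge> t0 \<Longrightarrow> \<theta> * t * \<gamma> t - \<theta> - 1 \<ge> 0"
    and p: "A p = b"
    and saddle: "\<And>z. f p \<le> aug_lagrangian f A b \<sigma> z ls"
begin

text \<open>Because \<open>A p = b\<close>, the subtracted value \<open>f p\<close> is the augmented
  Lagrangian at \<open>(p, ls)\<close>.\<close>

definition gap :: "'a \<Rightarrow> real" where
  "gap z = aug_lagrangian f A b \<sigma> z ls - f p"

text \<open>
  The parameter \<open>m\<close> is \<open>0\<close> for the growth estimate that holds on every trajectory and \<open>\<parallel>p\<parallel>\<^sup>2\<close> for
  trajectories outside the ball, where it makes the energy nonincreasing.
\<close>

definition energy :: "real \<Rightarrow> real \<Rightarrow> real" where
  "energy m t = \<theta>\<^sup>2 * t\<^sup>2 * \<beta> t * (gap (x t) + \<epsilon> t / 2 * ((norm (x t))\<^sup>2 - m))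
     + (norm (x t - p + (\<theta> * t) *\<^sub>R x' t))\<^sup>2 / 2
     + (\<theta> * t * \<gamma> t - \<theta> - 1) / 2 * (norm (x t - p))\<^sup>2
     + \<theta> / 2 * (norm (l t - ls))\<^sup>2"

lemma gap_nonneg: "gap z \<ge> 0"
  using saddle[of z] by (simp add: gap_def)

lemma gap_eq: "gap z = f z - f p + ls \<bullet> (A z - b) + \<sigma> / 2 * ((A z - b) \<bullet> (A z - b))"
  by (simp add: gap_def aug_lagrangian_def power2_norm_eq_inner)

lemma has_vector_derivative_A:
  "t \<ge> t0 \<Longrightarrow> ((\<lambda>t. A (x t)) has_vector_derivative A (x' t)) (at t within {t0..})"
  using bounded_linear.has_vector_derivative[OF A dx] .

lemma has_real_derivative_gap:
  assumes t: "t \<ge> t0"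
  shows "((\<lambda>t. gap (x t)) has_real_derivative
    x' t \<bullet> gradient f (x t) + A (x' t) \<bullet> ls + \<sigma> * (A (x' t) \<bullet> (A (x t) - b))) (at t within {t0..})"
proof -
  have "((\<lambda>t. f (x t)) has_derivative (\<lambda>h. (h *\<^sub>R x' t) \<bullet> gradient f (x t))) (at t within {t0..})"
    using GDERIV_gradient[OF diff, of "x t"] dx[OF t]
    unfolding gderiv_def has_vector_derivative_def by (rule has_derivative_compose[rotated])
  then have df: "((\<lambda>t. f (x t)) has_real_derivative x' t \<bullet> gradient f (x t)) (at t within {t0..})"
    by (simp add: has_field_derivative_def mult.commute[of _ "_ \<bullet> _"])
  note dA = has_vector_derivative_diff_const[THEN iffD2, OF has_vector_derivative_A[OF t]]
  show ?thesis
    unfolding gap_eq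
    by (rule derivative_eq_intros df has_real_derivative_inner[OF has_vector_derivative_const dA]
        has_real_derivative_inner[OF dA dA] refl)+ (simp add: inner_commute algebra_simps)
qed

text \<open>Substituting the system cancels the mixed terms: products of \<open>x - p\<close> and
  \<open>x'\<close> by the weight \<open>\<theta> * t * \<gamma> t - \<theta> - 1\<close>, the
  derivatives of \<open>gap (x t)\<close> and of the Tikhonov term along \<open>x'\<close> against
  \<open>x' \<bullet> x''\<close>, and the terms in \<open>l - ls\<close> against the derivative of
  the last summand.\<close>

lemma has_real_derivative_energy:
  assumes t: "t \<ge> t0"
  shows "(energy m has_real_derivative
      \<theta> * t * (2 * \<theta> * \<beta> t + \<theta> * t * \<beta>' t) * (gap (x t) + \<epsilon> t / 2 * ((norm (x t))\<^sup>2 - m))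
      + \<theta>\<^sup>2 * t\<^sup>2 * \<beta> t * \<epsilon>' t / 2 * ((norm (x t))\<^sup>2 - m)
      - \<theta> * t * (\<theta> * t * \<gamma> t - \<theta> - 1) * (norm (x' t))\<^sup>2
      - \<theta> * t * \<beta> t * ((x t - p) \<bullet> gradient f (x t) + (A (x t) - b) \<bullet> ls
          + \<sigma> * (norm (A (x t) - b))\<^sup>2 + \<epsilon> t * ((x t - p) \<bullet> x t))
      + \<theta> * (\<gamma> t + t * \<gamma>' t) / 2 * (norm (x t - p))\<^sup>2) (at t within {t0..})"
proof -
  interpret bounded_linear A by (rule A)
  define w where "w = (\<lambda>t. x t - p)"
  define u where "u = (\<lambda>t. w t + (\<theta> * t) *\<^sub>R x' t)"
  define h where "h = (\<lambda>t. A (x t) - b)"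
  define k where "k = (\<lambda>t. l t - ls)"
  define dgap where "dgap = x' t \<bullet> gradient f (x t) + A (x' t) \<bullet> ls + \<sigma> * (A (x' t) \<bullet> h t)"
  define u' where "u' = x' t + \<theta> *\<^sub>R x' t + (\<theta> * t) *\<^sub>R x'' t"
  have Aw: "A (w t) = h t" by (simp add: w_def h_def diff p)
  have dw: "(w has_vector_derivative x' t) (at t within {t0..})"
    unfolding w_def by (simp add: has_vector_derivative_diff_const dx t)
  have dk: "(k has_vector_derivative l' t) (at t within {t0..})"
    unfolding k_def by (simp add: has_vector_derivative_diff_const dl t)
  have "((\<lambda>t. (\<theta> * t) *\<^sub>R x' t) has_vector_derivative (\<theta> * t) *\<^sub>R x'' t + \<theta> *\<^sub>R x' t) (at t within {t0..})"
    by (rule has_vector_derivative_scaleR[OF _ dx'[OF t]]) (auto intro!: derivative_eq_intros)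
  from has_vector_derivative_add[OF dw this]
  have du: "(u has_vector_derivative u') (at t within {t0..})"
    unfolding u_def u'_def by (simp add: algebra_simps)
  have energy: "energy m = (\<lambda>t. \<theta>\<^sup>2 * t\<^sup>2 * \<beta> t * (gap (x t) + \<epsilon> t / 2 * (x t \<bullet> x t - m))
     + (u t \<bullet> u t) / 2 + (\<theta> * t * \<gamma> t - \<theta> - 1) / 2 * (w t \<bullet> w t) + \<theta> / 2 * (k t \<bullet> k t))"
    by (simp add: fun_eq_iff energy_def u_def w_def k_def power2_norm_eq_inner)
  note dinner = has_real_derivative_inner
  have dX: "((\<lambda>t. \<epsilon> t / 2 * (x t \<bullet> x t - m)) has_real_derivative
      \<epsilon>' t / 2 * (x t \<bullet> x t - m) + \<epsilon> t * (x' t \<bullet> x t)) (at t within {t0..})"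
    by (rule DERIV_cong[OF DERIV_mult[OF DERIV_cdivide[OF d\<epsilon>[OF t]]
          DERIV_diff[OF dinner[OF dx dx, OF t t] DERIV_const]]])
      (simp add: inner_commute)
  have "((\<lambda>t. \<theta> * t * \<gamma> t - \<theta> - 1) has_real_derivative \<theta> * \<gamma> t + \<theta> * t * \<gamma>' t) (at t within {t0..})"
    by (auto intro!: derivative_eq_intros d\<gamma> t)
  from DERIV_mult[OF DERIV_cdivide[OF this] dinner[OF dw dw]]
  have dW: "((\<lambda>t. (\<theta> * t * \<gamma> t - \<theta> - 1) / 2 * (w t \<bullet> w t)) has_real_derivative
      (\<theta> * \<gamma> t + \<theta> * t * \<gamma>' t) / 2 * (w t \<bullet> w t)
      + (\<theta> * t * \<gamma> t - \<theta> - 1) * (w t \<bullet> x' t)) (at t within {t0..})"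
    by (rule DERIV_cong) (simp add: inner_commute)
  have "((\<lambda>t. \<theta>\<^sup>2 * t\<^sup>2 * \<beta> t) has_real_derivative \<theta>\<^sup>2 * (2 * t) * \<beta> t + \<theta>\<^sup>2 * t\<^sup>2 * \<beta>' t) (at t within {t0..})"
    by (auto intro!: derivative_eq_intros d\<beta> t)
  note dP = DERIV_mult[OF this DERIV_add[OF has_real_derivative_gap[OF t] dX]]
  have d: "(energy m has_real_derivative
      \<theta>\<^sup>2 * (2 * t) * \<beta> t * (gap (x t) + \<epsilon> t / 2 * (x t \<bullet> x t - m))
      + \<theta>\<^sup>2 * t\<^sup>2 * \<beta>' t * (gap (x t) + \<epsilon> t / 2 * (x t \<bullet> x t - m))
      + \<theta>\<^sup>2 * t\<^sup>2 * \<beta> t * (dgap + \<epsilon>' t / 2 * (x t \<bullet> x t - m) + \<epsilon> t * (x' t \<bullet> x t))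
      + u t \<bullet> u'
      + (\<theta> * \<gamma> t + \<theta> * t * \<gamma>' t) / 2 * (w t \<bullet> w t)
      + (\<theta> * t * \<gamma> t - \<theta> - 1) * (w t \<bullet> x' t)
      + \<theta> * (k t \<bullet> l' t)) (at t within {t0..})"
    unfolding energy
    by (rule DERIV_cong[OF DERIV_add[OF DERIV_add[OF DERIV_add[OF dP
          DERIV_cdivide[OF dinner[OF du du]]] dW] DERIV_cmult[OF dinner[OF dk dk]]]])
      (simp add: dgap_def h_def inner_commute algebra_simps)
  \<comment> \<open>Splitting \<open>l t\<close> as \<open>ls + k t\<close> separates the part
    belonging to the gap from the part that cancels with \<open>k t \<bullet> l' t\<close>.\<close>
  have x'': "z \<bullet> x'' t = - \<gamma> t * (z \<bullet> x' t) - \<beta> t * (z \<bullet> gradient f (x t) + A z \<bullet> ls + A z \<bullet> k t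
      + \<sigma> * (A z \<bullet> h t) + \<epsilon> t * (z \<bullet> x t))" for z
    unfolding x''_eq[OF t]
    by (simp add: inner_diff_right inner_add_right inner_adjoint[OF A] h_def k_def algebra_simps)
  have l': "k t \<bullet> l' t = t * \<beta> t * (h t \<bullet> k t + \<theta> * t * (A (x' t) \<bullet> k t))"
    unfolding l'_eq[OF t] by (simp add: add scaleR h_def inner_commute algebra_simps)
  have uu': "u t \<bullet> u' = (1 + \<theta>) * (w t \<bullet> x' t) + \<theta> * t * (1 + \<theta>) * (x' t \<bullet> x' t)
      + \<theta> * t * (w t \<bullet> x'' t) + (\<theta> * t)\<^sup>2 * (x' t \<bullet> x'' t)"
    unfolding u_def u'_def by (simp add: algebra_simps inner_commute power2_eq_square)
  have wh: "x t - p = w t" "A (x t) - b = h t" by (simp_all add: w_def h_def)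
  show ?thesis
    by (rule DERIV_cong[OF d], unfold uu' x'' l' Aw dgap_def power2_norm_eq_inner wh)
      (simp add: field_simps power2_eq_square)
qed

text \<open>Convexity bounds the inner products from below by the gap. The three parameter
  conditions and the monotonicity of \<open>\<epsilon>\<close> then make every remaining term
  nonpositive except the multiple of \<open>(norm p)\<^sup>2 - m\<close>.\<close>

lemma energy_deriv_le:
  assumes t: "t \<ge> t0" and m: "m \<le> (norm (x t))\<^sup>2"
  obtains D where "(energy m has_real_derivative D) (at t within {t0..})"
    "D \<le> \<theta> / 2 * (t * \<beta> t * \<epsilon> t) * ((norm p)\<^sup>2 - m)"
proof
  let ?Q = "(norm (x t))\<^sup>2 - m" and ?W = "(norm (x t - p))\<^sup>2"
  let ?G = "gap (x t) + \<epsilon> t / 2 * ?Q"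
  let ?I = "(x t - p) \<bullet> gradient f (x t) + (A (x t) - b) \<bullet> ls
          + \<sigma> * (norm (A (x t) - b))\<^sup>2 + \<epsilon> t * ((x t - p) \<bullet> x t)"
  show "(energy m has_real_derivative
      \<theta> * t * (2 * \<theta> * \<beta> t + \<theta> * t * \<beta>' t) * ?G + \<theta>\<^sup>2 * t\<^sup>2 * \<beta> t * \<epsilon>' t / 2 * ?Q
      - \<theta> * t * (\<theta> * t * \<gamma> t - \<theta> - 1) * (norm (x' t))\<^sup>2 - \<theta> * t * \<beta> t * ?I
      + \<theta> * (\<gamma> t + t * \<gamma>' t) / 2 * ?W) (at t within {t0..})"
    by (rule has_real_derivative_energy[OF t])
  have tpos: "t > 0" using t t0 by simp
  have "f (x t) - f p \<le> (x t - p) \<bullet> gradient f (x t)"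
    using convex_gradient_inequality[OF conv diff, of "x t" p]
    by (simp add: inner_diff_left inner_diff_right inner_commute)
  moreover have "\<sigma> / 2 * ((A (x t) - b) \<bullet> (A (x t) - b)) \<ge> 0"
    using \<sigma> by simp
  ultimately have gap_le: "gap (x t) \<le> (x t - p) \<bullet> gradient f (x t) + (A (x t) - b) \<bullet> ls
      + \<sigma> * (norm (A (x t) - b))\<^sup>2"
    unfolding gap_eq power2_norm_eq_inner by (simp add: inner_commute)
  \<comment> \<open>This identity produces the term \<open>?W\<close>, which
    \<open>cond_\<gamma>\<close> absorbs, and the \<open>(norm p)\<^sup>2\<close> of the final
    bound.\<close>
  have inner_x: "(x t - p) \<bullet> x t = ((norm (x t))\<^sup>2 + ?W - (norm p)\<^sup>2) / 2"
    unfolding power2_norm_eq_inner by (simp add: algebra_simps inner_commute)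
  have I: "?I \<ge> gap (x t) + \<epsilon> t * (((norm (x t))\<^sup>2 + ?W - (norm p)\<^sup>2) / 2)"
    unfolding inner_x using gap_le by simp
  have "\<theta> * t * \<beta> t * ?I \<ge> \<theta> * t * \<beta> t * (gap (x t) + \<epsilon> t * (((norm (x t))\<^sup>2 + ?W - (norm p)\<^sup>2) / 2))"
    using \<theta> tpos \<beta>[OF t] by (intro mult_left_mono I) auto
  moreover have "\<theta> * t * ((2 * \<theta> - 1) * \<beta> t + \<theta> * t * \<beta>' t) * ?G \<le> 0"
    using \<theta> tpos cond_\<beta>[OF t] \<epsilon>(1)[OF t] m gap_nonneg
    by (intro mult_nonpos_nonneg mult_nonneg_nonpos add_nonneg_nonneg mult_nonneg_nonneg) auto
  moreover have "\<theta> / 2 * (\<gamma> t + t * \<gamma>' t - t * \<beta> t * \<epsilon> t) * ?W \<le> 0"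
    using \<theta> cond_\<gamma>[OF t] by (intro mult_nonpos_nonneg mult_nonneg_nonpos) auto
  moreover have "\<theta>\<^sup>2 * t\<^sup>2 * \<beta> t * \<epsilon>' t / 2 * ?Q \<le> 0"
    using \<beta>[OF t] \<epsilon>(2)[OF t] m by (intro mult_nonpos_nonneg divide_nonpos_pos mult_nonneg_nonpos) auto
  moreover have "\<theta> * t * (\<theta> * t * \<gamma> t - \<theta> - 1) * (norm (x' t))\<^sup>2 \<ge> 0"
    using \<theta> tpos cond_\<theta>[OF t] by (intro mult_nonneg_nonneg) auto
  \<comment> \<open>Absorbing one copy of \<open>\<theta> * t * \<beta> t * ?G\<close> turns the
    coefficient \<open>2 * \<theta>\<close> into \<open>2 * \<theta> - 1\<close>, as in
    \<open>cond_\<beta>\<close>.\<close>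
  moreover have "\<theta> * t * (2 * \<theta> * \<beta> t + \<theta> * t * \<beta>' t) * ?G
      - \<theta> * t * \<beta> t * (gap (x t) + \<epsilon> t * (((norm (x t))\<^sup>2 + ?W - (norm p)\<^sup>2) / 2))
      + \<theta> * (\<gamma> t + t * \<gamma>' t) / 2 * ?W
    = \<theta> * t * ((2 * \<theta> - 1) * \<beta> t + \<theta> * t * \<beta>' t) * ?G
      + \<theta> / 2 * (\<gamma> t + t * \<gamma>' t - t * \<beta> t * \<epsilon> t) * ?W
      + \<theta> / 2 * (t * \<beta> t * \<epsilon> t) * ((norm p)\<^sup>2 - m)"
    by (simp add: field_simps)
  ultimately show "\<theta> * t * (2 * \<theta> * \<beta> t + \<theta> * t * \<beta>' t) * ?G + \<theta>\<^sup>2 * t\<^sup>2 * \<beta> t * \<epsilon>' t / 2 * ?Q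
      - \<theta> * t * (\<theta> * t * \<gamma> t - \<theta> - 1) * (norm (x' t))\<^sup>2 - \<theta> * t * \<beta> t * ?I
      + \<theta> * (\<gamma> t + t * \<gamma>' t) / 2 * ?W
    \<le> \<theta> / 2 * (t * \<beta> t * \<epsilon> t) * ((norm p)\<^sup>2 - m)"
    by linarith
qed

lemma energy_ge:
  assumes t: "t \<ge> t0" and m: "m \<le> (norm (x t))\<^sup>2"
  shows "\<theta>\<^sup>2 * t\<^sup>2 * \<beta> t * gap (x t) \<le> energy m t"
    and "\<theta>\<^sup>2 * t\<^sup>2 * \<beta> t * (\<epsilon> t / 2 * ((norm (x t))\<^sup>2 - m)) \<le> energy m t"
    and "\<theta> / 2 * (norm (l t - ls))\<^sup>2 \<le> energy m t"
proof -
  have "\<theta>\<^sup>2 * t\<^sup>2 * \<beta> t * gap (x t) \<ge> 0"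
    using \<beta>[OF t] gap_nonneg by simp
  moreover have "\<theta>\<^sup>2 * t\<^sup>2 * \<beta> t * (\<epsilon> t / 2 * ((norm (x t))\<^sup>2 - m)) \<ge> 0"
    using \<beta>[OF t] \<epsilon>(1)[OF t] m by simp
  moreover have "(norm (x t - p + (\<theta> * t) *\<^sub>R x' t))\<^sup>2 / 2 \<ge> 0"
    by simp
  moreover have "(\<theta> * t * \<gamma> t - \<theta> - 1) / 2 * (norm (x t - p))\<^sup>2 \<ge> 0"
    using cond_\<theta>[OF t] by (intro mult_nonneg_nonneg) auto
  moreover have "\<theta> / 2 * (norm (l t - ls))\<^sup>2 \<ge> 0"
    using \<theta> by simp
  ultimately show "\<theta>\<^sup>2 * t\<^sup>2 * \<beta> t * gap (x t) \<le> energy m t"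
    and "\<theta>\<^sup>2 * t\<^sup>2 * \<beta> t * (\<epsilon> t / 2 * ((norm (x t))\<^sup>2 - m)) \<le> energy m t"
    and "\<theta> / 2 * (norm (l t - ls))\<^sup>2 \<le> energy m t"
    unfolding energy_def distrib_left by linarith+
qed

section \<open>Consequences of the integrability of
  \<open>\<beta> t * \<epsilon> t / t\<close>\<close>

text \<open>As \<open>K\<close> is nondecreasing, \<open>t\<^sup>2 * (K t - K T)\<close> has
  derivative at least \<open>t * \<beta> t * \<epsilon> t\<close>. Subtracting \<open>?C\<close>
  times this function, which vanishes at \<open>T\<close>, makes the energy nonincreasing.\<close>

lemma energy_growth:
  assumes dK: "\<And>t. t \<ge> t0 \<Longrightarrow> (K has_real_derivative \<beta> t * \<epsilon> t / t) (at t within {t0..})"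
    and T: "t0 \<le> T" "T \<le> t"
  shows "energy 0 t \<le> energy 0 T + \<theta> / 2 * (norm p)\<^sup>2 * t\<^sup>2 * (K t - K T)"
proof -
  let ?C = "\<theta> / 2 * (norm p)\<^sup>2"
  have K: "K T \<le> K s" if "T \<le> s" for s
  proof -
    have "- K s \<le> - K T"
    proof (rule has_real_derivative_nonpos_imp_le[OF _ that])
      fix t assume t: "T \<le> t"
      have "\<beta> t * \<epsilon> t / t \<ge> 0"
        using \<beta>[of t] \<epsilon>(1)[of t] t T t0 by simp
      then show "\<exists>D. ((\<lambda>t. - K t) has_real_derivative D) (at t within {T..}) \<and> D \<le> 0"
        using DERIV_minus[OF has_real_derivative_within_tail[OF dK T(1), of t]] t T by auto
    qed
    then show ?thesis by simp
  qed
  have "energy 0 t - ?C * (t\<^sup>2 * (K t - K T)) \<le> energy 0 T - ?C * (T\<^sup>2 * (K T - K T))"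
  proof (rule has_real_derivative_nonpos_imp_le[OF _ T(2)])
    fix s assume s: "T \<le> s"
    then have s0: "s \<ge> t0" "s > 0" using T t0 by auto
    obtain D where D: "(energy 0 has_real_derivative D) (at s within {t0..})"
      "D \<le> \<theta> / 2 * (s * \<beta> s * \<epsilon> s) * ((norm p)\<^sup>2 - 0)"
      using energy_deriv_le[OF s0(1), of 0] by auto
    have "((\<lambda>t. t\<^sup>2 * (K t - K T)) has_real_derivative 2 * s * (K s - K T) + s\<^sup>2 * (\<beta> s * \<epsilon> s / s))
        (at s within {t0..})"
      using dK[OF s0(1)] by (auto intro!: derivative_eq_intros)
    from DERIV_diff[OF D(1) DERIV_cmult[OF this, of ?C]]
    have "((\<lambda>t. energy 0 t - ?C * (t\<^sup>2 * (K t - K T))) has_real_derivative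
        D - ?C * (2 * s * (K s - K T) + s\<^sup>2 * (\<beta> s * \<epsilon> s / s))) (at s within {T..})"
      by (rule has_real_derivative_within_tail) (rule T)
    moreover have "D - ?C * (2 * s * (K s - K T) + s\<^sup>2 * (\<beta> s * \<epsilon> s / s)) \<le> 0"
    proof -
      have "?C * (2 * s * (K s - K T)) \<ge> 0"
        using \<theta> s0 K[OF s] by (intro mult_nonneg_nonneg) auto
      moreover have "?C * (s\<^sup>2 * (\<beta> s * \<epsilon> s / s)) = \<theta> / 2 * (s * \<beta> s * \<epsilon> s) * ((norm p)\<^sup>2 - 0)"
        using s0 by (simp add: power2_eq_square)
      ultimately show ?thesis
        using D(2) by (simp only: distrib_left)
    qed
    ultimately show "\<exists>D. ((\<lambda>t. energy 0 t - ?C * (t\<^sup>2 * (K t - K T))) has_real_derivative D)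
        (at s within {T..}) \<and> D \<le> 0"
      by blast
  qed
  then show ?thesis by (simp add: mult.assoc)
qed

text \<open>Past a late \<open>T\<close> the bounded nondecreasing \<open>K\<close> hardly grows, so
  the energy is eventually below any positive multiple of \<open>t\<^sup>2\<close>, while it
  dominates \<open>\<theta>\<^sup>2 * t\<^sup>2 * c * gap (x t)\<close>.\<close>

lemma gap_tendsto_zero:
  assumes dK: "\<And>t. t \<ge> t0 \<Longrightarrow> (K has_real_derivative \<beta> t * \<epsilon> t / t) (at t within {t0..})"
    and K: "\<And>t. t \<ge> t0 \<Longrightarrow> K t \<le> R"
    and c: "c > 0" "\<forall>\<^sub>F t in at_top. \<beta> t \<ge> c"
  shows "((\<lambda>t. gap (x t)) \<longlongrightarrow> 0) at_top"
proof (rule tendstoI)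
  fix \<eta> :: real assume "\<eta> > 0"
  define C where "C = \<theta> / 2 * (norm p)\<^sup>2"
  \<comment> \<open>Solves \<open>(C + 1) * e = \<theta>\<^sup>2 * c * \<eta>\<close>: the share
    \<open>C\<close> pays for the growth of \<open>K\<close>, the share 1 for
    \<open>energy 0 T / t\<^sup>2\<close>. The denominator stays positive when
    \<open>p = 0\<close>.\<close>
  define e where "e = \<theta>\<^sup>2 * c * \<eta> / (C + 1)"
  have C: "C \<ge> 0" using \<theta> by (simp add: C_def)
  then have e: "e > 0" using \<open>\<eta> > 0\<close> \<theta> c by (simp add: e_def)
  have bdd: "bdd_above (K ` {t0..})"
    using K by (auto intro!: bdd_aboveI[of _ R])
  obtain T where T: "T \<ge> t0" "K T > Sup (K ` {t0..}) - e"
    using less_cSupD[of "K ` {t0..}" "Sup (K ` {t0..}) - e"] e by auto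
  have KT: "K t - K T \<le> e" if "t \<ge> T" for t
    using cSup_upper[OF _ bdd, of "K t"] T that by auto
  have "((\<lambda>t. energy 0 T / t\<^sup>2) \<longlongrightarrow> 0) at_top"
    using tendsto_divide_0[OF tendsto_const filterlim_at_top_imp_at_infinity[OF
        filterlim_pow_at_top[OF _ filterlim_ident]], of 2 "energy 0 T"] by simp
  then have "\<forall>\<^sub>F t in at_top. energy 0 T / t\<^sup>2 < e"
    using e by (rule order_tendstoD)
  then show "\<forall>\<^sub>F t in at_top. dist (gap (x t)) 0 < \<eta>"
    using c(2) eventually_ge_at_top[of T] eventually_gt_at_top[of 0]
  proof eventually_elim
    case (elim t)
    have "\<theta>\<^sup>2 * t\<^sup>2 * c * gap (x t) \<le> \<theta>\<^sup>2 * t\<^sup>2 * \<beta> t * gap (x t)"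
      using elim gap_nonneg by (intro mult_right_mono mult_left_mono) auto
    also have "\<dots> \<le> energy 0 t"
      using elim T by (intro energy_ge) auto
    also have "\<dots> \<le> energy 0 T + C * t\<^sup>2 * (K t - K T)"
      unfolding C_def using elim T by (intro energy_growth dK) auto
    also have "\<dots> \<le> energy 0 T + C * t\<^sup>2 * e"
      using C KT elim by (intro add_left_mono mult_left_mono) auto
    also have "\<dots> < (C + 1) * t\<^sup>2 * e"
      using elim by (simp add: field_simps)
    finally have "t\<^sup>2 * (\<theta>\<^sup>2 * c * gap (x t)) < t\<^sup>2 * ((C + 1) * e)"
      by (simp add: mult_ac)
    then have "\<theta>\<^sup>2 * c * gap (x t) < (C + 1) * e"
      using elim by (simp only: mult_less_cancel_left_pos zero_less_power)
    also have "\<dots> = \<theta>\<^sup>2 * c * \<eta>"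
      using C by (simp add: e_def)
    finally show ?case
      using \<theta> c gap_nonneg by simp
  qed
qed

text \<open>Growth from \<open>t0\<close> on with \<open>K \<le> R\<close> bounds the energy by a
  multiple of \<open>t\<^sup>2\<close>, where \<open>t \<ge> t0\<close> absorbs the initial value;
  the last summand of the energy then controls the multiplier.\<close>

lemma multiplier_growth:
  assumes dK: "\<And>t. t \<ge> t0 \<Longrightarrow> (K has_real_derivative \<beta> t * \<epsilon> t / t) (at t within {t0..})"
    and K: "\<And>t. t \<ge> t0 \<Longrightarrow> K t \<le> R"
  obtains M where "M \<ge> 0" "\<And>t. t \<ge> t0 \<Longrightarrow> norm (l t - ls) \<le> M * t"
proof
  define C where "C = \<theta> / 2 * (norm p)\<^sup>2"
  define B where "B = 2 / \<theta> * (energy 0 t0 / t0\<^sup>2 + C * (R - K t0))"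
  have C: "C \<ge> 0" using \<theta> by (simp add: C_def)
  have E0: "energy 0 t0 \<ge> 0"
  proof -
    have "0 \<le> \<theta> / 2 * (norm (l t0 - ls))\<^sup>2"
      using \<theta> by simp
    also have "\<dots> \<le> energy 0 t0"
      by (intro energy_ge) auto
    finally show ?thesis .
  qed
  have B: "B \<ge> 0"
    unfolding B_def using \<theta> E0 C K[of t0]
    by (intro mult_nonneg_nonneg add_nonneg_nonneg divide_nonneg_nonneg) auto
  then show "sqrt B \<ge> 0" by simp
  fix t assume t: "t \<ge> t0"
  have "\<theta> / 2 * (norm (l t - ls))\<^sup>2 \<le> energy 0 t"
    using t by (intro energy_ge) auto
  also have "\<dots> \<le> energy 0 t0 + C * t\<^sup>2 * (K t - K t0)"
    unfolding C_def using t by (intro energy_growth dK) auto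
  also have "\<dots> \<le> energy 0 t0 / t0\<^sup>2 * t\<^sup>2 + C * t\<^sup>2 * (R - K t0)"
  proof (intro add_mono mult_left_mono)
    have "energy 0 t0 * t0\<^sup>2 \<le> energy 0 t0 * t\<^sup>2"
      using E0 t t0 by (intro mult_left_mono power_mono) auto
    then show "energy 0 t0 \<le> energy 0 t0 / t0\<^sup>2 * t\<^sup>2"
      using t0 by (simp add: field_simps)
  qed (use C K[OF t] in auto)
  also have "\<dots> = \<theta> / 2 * (B * t\<^sup>2)"
    using \<theta> by (simp add: B_def distrib_right)
  finally have "(norm (l t - ls))\<^sup>2 \<le> B * t\<^sup>2"
    using \<theta> by (simp only: mult_le_cancel_left_pos half_gt_zero)
  then have "sqrt ((norm (l t - ls))\<^sup>2) \<le> sqrt (B * t\<^sup>2)"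
    by (rule real_sqrt_le_mono)
  then show "norm (l t - ls) \<le> sqrt B * t"
    using t t0 by (simp add: real_sqrt_mult)
qed

section \<open>Convergence to the minimal-norm solution\<close>

text \<open>
  For \<open>h = A x - b\<close> the multiplier equation is the linear equation \<open>h + \<theta> t h' = l' / (t \<beta>)\<close> with
  integrating factor \<open>t powr (1 / \<theta>)\<close>.  The condition on \<open>\<beta>\<close> says that the weight \<open>w\<close> of
  \<open>l'\<close> is nondecreasing, so after integration by parts only the size of \<open>l\<close> matters.
\<close>

lemma constraint_tendsto_zero:
  assumes M: "M \<ge> 0" "\<And>t. t \<ge> t0 \<Longrightarrow> norm (l t - ls) \<le> M * t"
    and c: "c > 0" "\<forall>\<^sub>F t in at_top. \<beta> t \<ge> c"
  shows "((\<lambda>t. A (x t) - b) \<longlongrightarrow> 0) at_top"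
proof -
  interpret bounded_linear A by (rule A)
  obtain T where T: "T \<ge> t0" "\<And>t. t \<ge> T \<Longrightarrow> \<beta> t \<ge> c"
    using eventually_conj[OF c(2) eventually_ge_at_top[of t0]]
    unfolding eventually_at_top_linorder by blast
  define h where "h = (\<lambda>t. A (x t) - b)"
  define k where "k = (\<lambda>t. l t - ls)"
  \<comment> \<open>Multiplying the equation for \<open>h\<close> by
    \<open>t powr (1 / \<theta> - 1) / \<theta>\<close> shows that
    \<open>t powr (1 / \<theta>) *\<^sub>R h t\<close> has derivative
    \<open>w t *\<^sub>R l' t\<close>.\<close>
  define w where "w = (\<lambda>t. t powr (1 / \<theta> - 2) / (\<theta> * \<beta> t))"
  \<comment> \<open>The derivative of \<open>w\<close>, written with the expression of
    \<open>cond_\<beta>\<close> as a factor so that its sign can be read off.\<close>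
  define w' where "w' = (\<lambda>t. - (t powr (1 / \<theta> - 3)) / (\<theta> * \<beta> t)\<^sup>2
      * ((2 * \<theta> - 1) * \<beta> t + \<theta> * t * \<beta>' t))"
  \<comment> \<open>Subtracting \<open>w t *\<^sub>R k t\<close> removes \<open>l'\<close> from the
    derivative and leaves \<open>- w' t *\<^sub>R k t\<close>.\<close>
  define V where "V = (\<lambda>t. t powr (1 / \<theta>) *\<^sub>R h t - w t *\<^sub>R k t)"
  have pos: "\<beta> t > 0" "t > 0" "t \<ge> t0" if "t \<ge> T" for t
    using T(2)[OF that] c T(1) t0 that by auto
  have dw: "(w has_real_derivative w' t) (at t within {t0..})" if t: "t \<ge> T" for t
  proof -
    have "t powr (1 / \<theta> - 2) = t * t powr (1 / \<theta> - 3)"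
      using pos[OF t] powr_mult_base[of t "1 / \<theta> - 3"] by simp
    moreover have "((\<lambda>t. t powr (1 / \<theta> - 2)) has_real_derivative (1 / \<theta> - 2) * t powr (1 / \<theta> - 3))
        (at t within {t0..})"
      using has_real_derivative_powr[of t "1 / \<theta> - 2"] pos[OF t] by (auto intro: DERIV_subset)
    from DERIV_divide[OF this DERIV_cmult[OF d\<beta>, of t \<theta>]]
    have "(w has_real_derivative ((1 / \<theta> - 2) * t powr (1 / \<theta> - 3) * (\<theta> * \<beta> t)
        - t powr (1 / \<theta> - 2) * (\<theta> * \<beta>' t)) / ((\<theta> * \<beta> t) * (\<theta> * \<beta> t))) (at t within {t0..})"
      using pos[OF t] \<theta> unfolding w_def by simp
    ultimately show ?thesis
      unfolding w'_def using pos[OF t] \<theta>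
      by (elim DERIV_cong) (simp add: field_simps power2_eq_square)
  qed
  have w': "w' t \<ge> 0" if "t \<ge> T" for t
    unfolding w'_def using cond_\<beta>[of t] pos[OF that]
    by (intro mult_nonpos_nonpos divide_nonpos_nonneg) auto
  have w: "w t \<ge> 0" if "t \<ge> T" for t
    using pos[OF that] \<theta> by (simp add: w_def)
  have dh: "(h has_vector_derivative A (x' t)) (at t within {t0..})" if "t \<ge> T" for t
    unfolding h_def using has_vector_derivative_A[of t] pos[OF that]
    by (simp add: has_vector_derivative_diff_const)
  have dk: "(k has_vector_derivative l' t) (at t within {t0..})" if "t \<ge> T" for t
    unfolding k_def using dl[of t] pos[OF that] by (simp add: has_vector_derivative_diff_const)
  have dV: "(V has_vector_derivative - w' t *\<^sub>R k t) (at t within {t0..})" if t: "t \<ge> T" for t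
  proof -
    have powr: "t powr (1 / \<theta>) = t * t powr (1 / \<theta> - 1)" "t powr (1 / \<theta> - 1) = t * t powr (1 / \<theta> - 2)"
      using pos[OF t] powr_mult_base[of t "1 / \<theta> - 1"] powr_mult_base[of t "1 / \<theta> - 2"] by simp_all
    have dp: "((\<lambda>t. t powr (1 / \<theta>)) has_real_derivative (1 / \<theta>) * t powr (1 / \<theta> - 1)) (at t within {t0..})"
      using has_real_derivative_powr[of t "1 / \<theta>"] pos[OF t] by (auto intro: DERIV_subset)
    have wl: "w t *\<^sub>R l' t = (t powr (1 / \<theta> - 1) / \<theta>) *\<^sub>R h t + (t * t powr (1 / \<theta> - 1)) *\<^sub>R A (x' t)"
      unfolding l'_eq[OF pos(3)[OF t]] w_def h_def powr(2) using pos[OF t] \<theta>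
      by (simp add: add scaleR scaleR_add_right scaleR_diff_right mult_ac)
    show ?thesis
      unfolding V_def
      by (rule has_vector_derivative_eq_rhs[OF has_vector_derivative_diff[OF
            has_vector_derivative_scaleR[OF dp dh[OF t]] has_vector_derivative_scaleR[OF dw[OF t] dk[OF t]]]])
        (simp add: wl powr(1))
  qed
  have V: "norm (V t - V T) \<le> M * t * w t" if t: "t \<ge> T" for t
  proof (cases "t = T")
    case True
    then show ?thesis using M pos[OF t] w[OF t] by simp
  next
    case False
    have "continuous_on {T..} V" "continuous_on {T..} w"
      unfolding continuous_on_eq_continuous_within using dV dw T(1)
      by (auto intro: continuous_within_subset[of _ "{t0..}"] has_vector_derivative_continuous
          DERIV_continuous)
    then have cont: "continuous_on {T..t} V" "continuous_on {T..t} (\<lambda>s. M * t * w s)"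
      by (auto intro!: continuous_intros elim: continuous_on_subset)
    have at: "at s within {t0..} = at s" if "T < s" for s
      using that T(1) by (intro at_within_interior) (auto simp: interior_real_atLeast)
    \<comment> \<open>With \<open>t\<close> fixed, \<open>norm (k s) \<le> M * t\<close> on the
      whole interval, so the nondecreasing function \<open>M * t * w s\<close> majorises the
      variation of \<open>V\<close>.\<close>
    have "norm (V t - V T) \<le> M * t * w t - M * t * w T"
    proof (rule differentiable_bound_general[OF _ cont])
      fix s assume s: "T < s" "s < t"
      show "(V has_vector_derivative - w' s *\<^sub>R k s) (at s)"
        using dV[of s] s at by simp
      show "((\<lambda>s. M * t * w s) has_vector_derivative M * t * w' s) (at s)"
        using DERIV_cmult[OF dw[of s]] s at
        by (simp add: has_real_derivative_iff_has_vector_derivative)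
      have "norm (k s) \<le> M * t"
        using M(2)[of s] mult_left_mono[of s t M] s T(1) M(1) unfolding k_def by simp
      then have "w' s * norm (k s) \<le> w' s * (M * t)"
        using w'[of s] s by (intro mult_left_mono) auto
      then show "norm (- w' s *\<^sub>R k s) \<le> M * t * w' s"
        using w'[of s] s by (simp add: mult.commute)
    qed (use t False in auto)
    moreover have "M * t * w T \<ge> 0"
      using M pos[OF t] w[of T] by simp
    ultimately show ?thesis by simp
  qed
  \<comment> \<open>After division by \<open>t powr (1 / \<theta>)\<close>, the terms of size
    \<open>M * t * w t\<close> decay like \<open>1 / t\<close>, because \<open>\<beta>\<close> is
    bounded below by \<open>c\<close>.\<close>
  have bound: "norm (h t) \<le> norm (V T) * t powr (- 1 / \<theta>) + 2 * M / (\<theta> * c) * (1 / t)" if t: "t \<ge> T" for t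
  proof -
    have "t powr (1 / \<theta>) * norm (h t) = norm (V T + (V t - V T) + w t *\<^sub>R k t)"
      by (simp add: V_def)
    also have "\<dots> \<le> norm (V T) + norm (V t - V T) + norm (w t *\<^sub>R k t)"
      by (intro norm_triangle_le add_mono norm_triangle_ineq) auto
    also have "\<dots> \<le> norm (V T) + M * t * w t + M * t * w t"
    proof -
      have "w t * norm (k t) \<le> w t * (M * t)"
        using M(2)[OF pos(3)[OF t]] w[OF t] unfolding k_def by (intro mult_left_mono) auto
      then show ?thesis
        using V[OF t] w[OF t] by (simp add: mult_ac)
    qed
    finally have "t powr (- 1 / \<theta>) * (t powr (1 / \<theta>) * norm (h t))
        \<le> t powr (- 1 / \<theta>) * (norm (V T) + 2 * M * t * w t)"
      by (intro mult_left_mono) auto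
    moreover have "t powr (- 1 / \<theta>) * (t powr (1 / \<theta>) * norm (h t)) = norm (h t)"
      using pos[OF t] by (simp flip: mult.assoc powr_add)
    moreover have "t powr (- 1 / \<theta>) * (2 * M * t * w t) = 2 * M / (\<theta> * \<beta> t) * (1 / t)"
    proof -
      have "t powr (- 1 / \<theta>) * t powr (1 / \<theta> - 2) = 1 / t\<^sup>2"
      proof -
        have "t powr (- 1 / \<theta>) * t powr (1 / \<theta> - 2) = t powr (- 1 / \<theta> + (1 / \<theta> - 2))"
          by (rule powr_add[symmetric])
        also have "- 1 / \<theta> + (1 / \<theta> - 2) = - 2"
          by simp
        finally show ?thesis
          using pos[OF t] by (simp add: powr_minus_divide)
      qed
      then show ?thesis
        using pos[OF t] \<theta> unfolding w_def by (simp add: field_simps power2_eq_square)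
    qed
    moreover have "2 * M / (\<theta> * \<beta> t) * (1 / t) \<le> 2 * M / (\<theta> * c) * (1 / t)"
      using M T(2)[OF t] c \<theta> pos[OF t]
      by (intro mult_right_mono divide_left_mono mult_left_mono mult_pos_pos) auto
    ultimately show ?thesis
      unfolding distrib_left by (simp only: mult.commute[of "norm (V T)"])
  qed
  have "((\<lambda>t. t powr (- 1 / \<theta>)) \<longlongrightarrow> 0) at_top"
    using \<theta> by (intro tendsto_neg_powr filterlim_ident) auto
  moreover have "((\<lambda>t::real. 1 / t) \<longlongrightarrow> 0) at_top"
    using tendsto_inverse_0_at_top[OF filterlim_ident] by (simp add: inverse_eq_divide)
  ultimately have "((\<lambda>t. norm (V T) * t powr (- 1 / \<theta>) + 2 * M / (\<theta> * c) * (1 / t))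
      \<longlongrightarrow> norm (V T) * 0 + 2 * M / (\<theta> * c) * 0) at_top"
    by (intro tendsto_intros)
  then have "((\<lambda>t. norm (V T) * t powr (- 1 / \<theta>) + 2 * M / (\<theta> * c) * (1 / t)) \<longlongrightarrow> 0) at_top"
    by simp
  moreover have "\<forall>\<^sub>F t in at_top. norm (h t) \<le> norm (V T) * t powr (- 1 / \<theta>) + 2 * M / (\<theta> * c) * (1 / t)"
    using eventually_ge_at_top[of T] by eventually_elim (rule bound)
  ultimately have "(h \<longlongrightarrow> 0) at_top"
    by (rule Lim_null_comparison[rotated])
  then show ?thesis unfolding h_def .
qed

lemma p_in_solution_set: "p \<in> solution_set f A b"
proof -
  have "f p \<le> f y" if "A y = b" for y
    using saddle[of y] that by (simp add: aug_lagrangian_def)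
  then show ?thesis
    using p by (simp add: solution_set_def)
qed

end

section \<open>Distance of the trajectory from the minimal-norm solution\<close>

locale tikhonov_flow = primal_dual_flow +
  fixes K :: "real \<Rightarrow> real" and R c :: real
  assumes dK: "\<And>t. t \<ge> t0 \<Longrightarrow> (K has_real_derivative \<beta> t * \<epsilon> t / t) (at t within {t0..})"
    and K: "\<And>t. t \<ge> t0 \<Longrightarrow> K t \<le> R"
    and c: "c > 0" "\<forall>\<^sub>F t in at_top. \<beta> t \<ge> c"
    and lim: "filterlim (\<lambda>t. t\<^sup>2 * \<beta> t * \<epsilon> t) at_top at_top"
    and p_eq: "p = Proj (solution_set f A b) 0"
begin

text \<open>Both the gap and \<open>A (x t) - b\<close> tend to zero, hence so does
  \<open>f (x t) - f p\<close>. At late times only the norm condition of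
  \<open>near_solution_imp_near_Proj\<close> remains open.\<close>

lemma eventually_near:
  assumes "\<eta> > 0"
  obtains \<delta> where "\<delta> > 0" "\<forall>\<^sub>F t in at_top. norm (x t) \<le> norm p + \<delta> \<longrightarrow> norm (x t - p) < \<eta>"
proof -
  have cont: "continuous_on UNIV f"
    using diff differentiable_imp_continuous_within by (auto simp: continuous_on_eq_continuous_within)
  obtain \<delta> where \<delta>: "\<delta> > 0" and near: "\<And>z. norm (A z - b) \<le> \<delta> \<Longrightarrow> f z \<le> f p + \<delta> \<Longrightarrow>
      norm z \<le> norm p + \<delta> \<Longrightarrow> norm (z - p) < \<eta>"
    using near_solution_imp_near_Proj[OF conv cont A _ p_eq assms] p_in_solution_set by blast
  obtain M where M: "M \<ge> 0" "\<And>t. t \<ge> t0 \<Longrightarrow> norm (l t - ls) \<le> M * t"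
    using multiplier_growth[OF dK K] by blast
  have h: "((\<lambda>t. A (x t) - b) \<longlongrightarrow> 0) at_top"
    by (rule constraint_tendsto_zero[OF M c])
  have "((\<lambda>t. gap (x t) - ls \<bullet> (A (x t) - b) - \<sigma> / 2 * ((A (x t) - b) \<bullet> (A (x t) - b)))
      \<longlongrightarrow> 0 - ls \<bullet> 0 - \<sigma> / 2 * ((0::'b) \<bullet> 0)) at_top"
    by (rule tendsto_diff[OF tendsto_diff[OF gap_tendsto_zero[OF dK K c]
          tendsto_inner[OF tendsto_const h]] tendsto_mult[OF tendsto_const tendsto_inner[OF h h]]])
  then have "((\<lambda>t. f (x t) - f p) \<longlongrightarrow> 0) at_top"
    by (simp add: gap_eq)
  then have "\<forall>\<^sub>F t in at_top. f (x t) - f p < \<delta>"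
    using \<delta> by (rule order_tendstoD)
  moreover have "\<forall>\<^sub>F t in at_top. norm (A (x t) - b) < \<delta>"
    using tendstoD[OF h \<delta>] by simp
  ultimately have "\<forall>\<^sub>F t in at_top. norm (x t) \<le> norm p + \<delta> \<longrightarrow> norm (x t - p) < \<eta>"
    by eventually_elim (use near in auto)
  with \<delta> that show ?thesis by blast
qed

lemma tendsto_if_inside:
  assumes "\<forall>\<^sub>F t in at_top. norm (x t) \<le> norm p"
  shows "((\<lambda>t. norm (x t - p)) \<longlongrightarrow> 0) at_top"
proof (rule tendstoI)
  fix \<eta> :: real assume "\<eta> > 0"
  then obtain \<delta> where "\<delta> > 0"
    "\<forall>\<^sub>F t in at_top. norm (x t) \<le> norm p + \<delta> \<longrightarrow> norm (x t - p) < \<eta>"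
    by (rule eventually_near)
  then show "\<forall>\<^sub>F t in at_top. dist (norm (x t - p)) 0 < \<eta>"
    using assms by (auto elim: eventually_elim2)
qed

text \<open>For \<open>m = (norm p)\<^sup>2\<close> the bound on the energy derivative is zero, so
  the energy stays below its value at \<open>T\<close>. Up to a constant it dominates
  \<open>t\<^sup>2 * \<beta> t * \<epsilon> t\<close> times the excess of
  \<open>(norm (x t))\<^sup>2\<close> over \<open>m\<close>, and this weight tends to
  infinity.\<close>

lemma tendsto_if_outside:
  assumes T: "T \<ge> t0" and out: "\<And>t. t \<ge> T \<Longrightarrow> norm (x t) \<ge> norm p"
  shows "((\<lambda>t. norm (x t - p)) \<longlongrightarrow> 0) at_top"
proof (rule tendstoI)
  fix \<eta> :: real assume "\<eta> > 0"
  then obtain \<delta> where \<delta>: "\<delta> > 0"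
    "\<forall>\<^sub>F t in at_top. norm (x t) \<le> norm p + \<delta> \<longrightarrow> norm (x t - p) < \<eta>"
    by (rule eventually_near)
  define m where "m = (norm p)\<^sup>2"
  have m: "m \<le> (norm (x t))\<^sup>2" if "t \<ge> T" for t
    unfolding m_def using out[OF that] by (intro power_mono) auto
  have E: "energy m t \<le> energy m T" if "t \<ge> T" for t
  proof (rule has_real_derivative_nonpos_imp_le[OF _ that])
    fix s assume s: "T \<le> s"
    then obtain D where "(energy m has_real_derivative D) (at s within {t0..})"
      "D \<le> \<theta> / 2 * (s * \<beta> s * \<epsilon> s) * ((norm p)\<^sup>2 - m)"
      using energy_deriv_le[OF _ m] T by (metis order_trans)
    then show "\<exists>D. (energy m has_real_derivative D) (at s within {T..}) \<and> D \<le> 0"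
      using has_real_derivative_within_tail[OF _ T] by (auto simp: m_def)
  qed
  \<comment> \<open>Once the weight exceeds \<open>N\<close>, an excess above
    \<open>\<delta>\<^sup>2\<close> would lift the energy at \<open>t\<close> above its value at
    \<open>T\<close>.\<close>
  define N where "N = 2 * energy m T / (\<theta>\<^sup>2 * \<delta>\<^sup>2)"
  have "\<forall>\<^sub>F t in at_top. t\<^sup>2 * \<beta> t * \<epsilon> t > max N 0"
    using lim unfolding filterlim_at_top_dense by blast
  then show "\<forall>\<^sub>F t in at_top. dist (norm (x t - p)) 0 < \<eta>"
    using \<delta>(2) eventually_ge_at_top[of T]
  proof eventually_elim
    case (elim t)
    have "(norm (x t))\<^sup>2 - m \<le> \<delta>\<^sup>2"
    proof (rule ccontr)
      assume "\<not> ?thesis"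
      then have "(t\<^sup>2 * \<beta> t * \<epsilon> t) * \<delta>\<^sup>2 \<le> (t\<^sup>2 * \<beta> t * \<epsilon> t) * ((norm (x t))\<^sup>2 - m)"
        using elim(1) by (intro mult_left_mono) auto
      moreover have "N * \<delta>\<^sup>2 < (t\<^sup>2 * \<beta> t * \<epsilon> t) * \<delta>\<^sup>2"
        using elim(1) \<delta>(1) by (intro mult_strict_right_mono) auto
      ultimately have "N * \<delta>\<^sup>2 < (t\<^sup>2 * \<beta> t * \<epsilon> t) * ((norm (x t))\<^sup>2 - m)"
        by linarith
      then have "\<theta>\<^sup>2 / 2 * (N * \<delta>\<^sup>2) < \<theta>\<^sup>2 / 2 * ((t\<^sup>2 * \<beta> t * \<epsilon> t) * ((norm (x t))\<^sup>2 - m))"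
        using \<theta> by (intro mult_strict_left_mono) auto
      also have "\<dots> = \<theta>\<^sup>2 * t\<^sup>2 * \<beta> t * (\<epsilon> t / 2 * ((norm (x t))\<^sup>2 - m))"
        by simp
      also have "\<dots> \<le> energy m t"
        using elim T m by (intro energy_ge) auto
      also have "\<dots> \<le> energy m T"
        using elim by (intro E)
      also have "\<dots> = \<theta>\<^sup>2 / 2 * (N * \<delta>\<^sup>2)"
        using \<theta> \<delta>(1) by (simp add: N_def)
      finally show False by simp
    qed
    \<comment> \<open>Expanding the square shows that an excess of \<open>\<delta>\<^sup>2\<close>
      in squared norms costs at most \<open>\<delta>\<close> in norm.\<close>
    also have "\<delta>\<^sup>2 \<le> (norm p + \<delta>)\<^sup>2 - m"
      using \<delta>(1) by (simp add: m_def power2_sum)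
    finally have "(norm (x t))\<^sup>2 \<le> (norm p + \<delta>)\<^sup>2"
      by simp
    moreover have "0 \<le> norm p + \<delta>"
      using \<delta>(1) by simp
    ultimately have "norm (x t) \<le> norm p + \<delta>"
      by (rule power2_le_imp_le)
    then show ?case using elim by simp
  qed
qed

text \<open>Either the trajectory finally stays outside the open ball and converges, or it is in the
  closed ball at arbitrarily late times, where \<open>eventually_near\<close> applies.\<close>

lemma frequently_near:
  assumes "\<eta> > 0"
  shows "\<exists>\<^sub>F t in at_top. norm (x t - p) < \<eta>"
proof (cases "\<exists>T\<ge>t0. \<forall>t\<ge>T. norm (x t) \<ge> norm p")
  case True
  then have "((\<lambda>t. norm (x t - p)) \<longlongrightarrow> 0) at_top"
    using tendsto_if_outside by blast
  then have "\<forall>\<^sub>F t in at_top. norm (x t - p) < \<eta>"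
    using assms by (rule order_tendstoD)
  then show ?thesis
    by (rule eventually_frequently[rotated]) simp
next
  case False
  have "\<exists>\<^sub>F t in at_top. norm (x t) \<le> norm p"
    unfolding frequently_def eventually_at_top_linorder
  proof
    assume "\<exists>N. \<forall>n\<ge>N. \<not> norm (x n) \<le> norm p"
    then obtain N where "\<forall>n\<ge>N. \<not> norm (x n) \<le> norm p" by blast
    then have "\<forall>t\<ge>max N t0. norm (x t) \<ge> norm p" by (auto simp: not_le intro: less_imp_le)
    with False show False by (metis max.cobounded2)
  qed
  moreover obtain \<delta> where "\<delta> > 0"
    "\<forall>\<^sub>F t in at_top. norm (x t) \<le> norm p + \<delta> \<longrightarrow> norm (x t - p) < \<eta>"
    using assms by (rule eventually_near)
  ultimately show ?thesis
    by (auto elim: frequently_rev_mp elim!: eventually_mono)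
qed

end

theorem theorem3p1:
  fixes f :: "'a::{real_inner, complete_space} \<Rightarrow> real"
    and A :: "'a \<Rightarrow> 'b::{real_inner, complete_space}"
    and b :: 'b
    and \<theta> t0 \<sigma> :: real
    and \<epsilon> \<gamma> \<beta> \<epsilon>' \<gamma>' \<beta>' :: "real \<Rightarrow> real"
    and x :: "real \<Rightarrow> 'a"
    and l :: "real \<Rightarrow> 'b"
    and xhat :: 'a
  assumes f_convex: "convex_on UNIV f"
    and f_C1: "continuously_differentiable f"
    and f_grad_lipschitz: "\<exists>L. L-lipschitz_on UNIV (gradient f)"
    and A_linear: "bounded_linear A"
    and slater: "slater_condition A b"
    and theta_pos: "\<theta> > 0"
    and t0_pos: "t0 > 0"
    and sigma_nonneg: "\<sigma> \<ge> 0"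
    and saddle: "saddle_points f A b \<sigma> \<noteq> {}"
    and eps_C1: "C1_with_deriv t0 \<epsilon> \<epsilon>'"
    and eps_nonneg: "\<And>t. t \<ge> t0 \<Longrightarrow> \<epsilon> t \<ge> 0"
    and eps_antimono: "antimono_on {t0..} \<epsilon>"
    and gamma_C1: "C1_with_deriv t0 \<gamma> \<gamma>'"
    and gamma_nonneg: "\<And>t. t \<ge> t0 \<Longrightarrow> \<gamma> t \<ge> 0"
    and beta_C1: "C1_with_deriv t0 \<beta> \<beta>'"
    and beta_nonneg: "\<And>t. t \<ge> t0 \<Longrightarrow> \<beta> t \<ge> 0"
    and cond_beta: "\<And>t. t \<ge> t0 \<Longrightarrow> (2 * \<theta> - 1) * \<beta> t + \<theta> * t * \<beta>' t \<le> 0"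
    and cond_gamma: "\<And>t. t \<ge> t0 \<Longrightarrow> \<gamma> t + t * \<gamma>' t \<le> t * \<beta> t * \<epsilon> t"
    and cond_theta: "\<And>t. t \<ge> t0 \<Longrightarrow> \<theta> * t * \<gamma> t - \<theta> - 1 \<ge> 0"
    and integral_finite: "(\<lambda>t. \<beta> t * \<epsilon> t / t) integrable_on {t0..}"
    and liminf_beta: "Liminf at_top (\<lambda>t. ereal (\<beta> t)) \<noteq> 0"
    and lim_infinite: "filterlim (\<lambda>t. t\<^sup>2 * \<beta> t * \<epsilon> t) at_top at_top"
    and solution: "global_solution f A b \<sigma> \<theta> t0 \<epsilon> \<gamma> \<beta> x l"
    and xhat: "xhat = Proj (solution_set f A b) 0"
  shows "Liminf at_top (\<lambda>t. ereal (norm (x t - xhat))) = 0 \<and>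
    ((\<exists>T\<ge>t0. (\<forall>t\<ge>T. x t \<in> ball 0 (norm xhat)) \<or> (\<forall>t\<ge>T. x t \<in> - ball 0 (norm xhat)))
      \<longrightarrow> ((\<lambda>t. norm (x t - xhat)) \<longlongrightarrow> 0) at_top)"
proof -
  have diff: "\<And>z. f differentiable (at z)"
    using f_C1 by (simp add: continuously_differentiable_def)
  have cont: "continuous_on UNIV f"
    using diff differentiable_imp_continuous_within by (auto simp: continuous_on_eq_continuous_within)
  obtain xs ls where sad: "\<And>z k. aug_lagrangian f A b \<sigma> xs k \<le> aug_lagrangian f A b \<sigma> xs ls"
    "\<And>z. aug_lagrangian f A b \<sigma> xs ls \<le> aug_lagrangian f A b \<sigma> z ls"
    using saddle by (auto simp: saddle_points_def)
  have xs: "A xs = b"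
  proof -
    \<comment> \<open>Testing maximality in the multiplier at \<open>ls + (A xs - b)\<close> leaves
      exactly the squared residual.\<close>
    have "(A xs - b) \<bullet> (A xs - b) \<le> 0"
      using sad(1)[of "ls + (A xs - b)"] by (simp add: aug_lagrangian_def inner_add_left)
    then show ?thesis
      using inner_gt_zero_iff[of "A xs - b"] by (metis not_less right_minus_eq)
  qed
  have "f xs \<le> f y" if "A y = b" for y
    using sad(2)[of y] that xs by (simp add: aug_lagrangian_def)
  with xs have "xs \<in> solution_set f A b"
    by (simp add: solution_set_def)
  note S = this sublevel_closed_convex[OF f_convex cont A_linear, of b 0 "f xs",
      folded solution_set_eq_sublevel[OF this]]
  have xhat_S: "xhat \<in> solution_set f A b"
    unfolding xhat by (rule Proj_zero(1)) (use S in auto)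
  \<comment> \<open>All solutions share the value \<open>f xs\<close>, so the multiplier
    \<open>ls\<close> found with \<open>xs\<close> also serves \<open>xhat\<close>.\<close>
  then have "f xhat = f xs" "A xhat = b"
    using S(1) by (auto simp: solution_set_def intro: antisym)
  with sad(2) xs have min: "f xhat \<le> aug_lagrangian f A b \<sigma> z ls" for z
    by (simp add: aug_lagrangian_def)
  obtain x' x'' l' where
    sol: "(x has_vector_derivative x' t) (at t within {t0..})"
      "(x' has_vector_derivative x'' t) (at t within {t0..})"
      "(l has_vector_derivative l' t) (at t within {t0..})"
      "x'' t + \<gamma> t *\<^sub>R x' t + \<beta> t *\<^sub>R (gradient f (x t) + adjoint A (l t)
         + \<sigma> *\<^sub>R adjoint A (A (x t) - b) + \<epsilon> t *\<^sub>R x t) = 0"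
      "l' t - (t * \<beta> t) *\<^sub>R (A (x t + (\<theta> * t) *\<^sub>R x' t) - b) = 0" if "t \<ge> t0" for t
    using solution unfolding global_solution_def by blast
  have cont_g: "continuous_on {t0..} (\<lambda>t. \<beta> t * \<epsilon> t / t)"
    using t0_pos eps_C1 beta_C1
    by (intro continuous_intros; auto simp: C1_with_deriv_def intro!: DERIV_continuous_on)
  obtain K R where K: "\<And>t. t \<ge> t0 \<Longrightarrow> (K has_real_derivative \<beta> t * \<epsilon> t / t) (at t within {t0..})"
    "\<And>t. t \<ge> t0 \<Longrightarrow> K t \<le> R"
    using bounded_primitive[OF cont_g _ integral_finite] eps_nonneg beta_nonneg t0_pos by auto
  \<comment> \<open>Being nonnegative and nonzero, the lower limit lies above some positive real
    \<open>c\<close>, an eventual lower bound for \<open>\<beta>\<close>.\<close>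
  have "Liminf at_top (\<lambda>t. ereal (\<beta> t)) \<ge> 0"
    using beta_nonneg by (intro Liminf_bounded eventually_mono[OF eventually_ge_at_top[of t0]]) auto
  with liminf_beta obtain c where c: "0 < ereal c" "ereal c < Liminf at_top (\<lambda>t. ereal (\<beta> t))"
    using ereal_dense2[of 0] by (auto simp: less_le)
  then have c': "\<forall>\<^sub>F t in at_top. \<beta> t \<ge> c"
    using less_LiminfD[OF c(2)] by (auto elim: eventually_mono)
  have move: "u = - v - w" if "u + v + w = 0" for u v w :: 'a
  proof -
    have "u = (u + v + w) - v - w" by simp
    with that show ?thesis by simp
  qed
  interpret tikhonov_flow f A b \<theta> t0 \<sigma> \<epsilon> \<gamma> \<beta> \<epsilon>' \<gamma>' \<beta>' x x' x'' l l' xhat ls K R c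
  proof (intro tikhonov_flow.intro primal_dual_flow.intro tikhonov_flow_axioms.intro)
    fix t assume t: "t \<ge> t0"
    show "x'' t = - (\<gamma> t *\<^sub>R x' t) - \<beta> t *\<^sub>R (gradient f (x t)
      + adjoint A (l t) + \<sigma> *\<^sub>R adjoint A (A (x t) - b) + \<epsilon> t *\<^sub>R x t)"
      by (rule move[OF sol(4)[OF t]])
    show "l' t = (t * \<beta> t) *\<^sub>R (A (x t + (\<theta> * t) *\<^sub>R x' t) - b)"
      using sol(5)[OF t] by simp
    show "\<epsilon>' t \<le> 0"
      using antimono_imp_deriv_nonpos[OF eps_antimono t] eps_C1 t by (auto simp: C1_with_deriv_def)
    show "(\<epsilon> has_real_derivative \<epsilon>' t) (at t within {t0..})"
      "(\<gamma> has_real_derivative \<gamma>' t) (at t within {t0..})"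
      "(\<beta> has_real_derivative \<beta>' t) (at t within {t0..})"
      using eps_C1 gamma_C1 beta_C1 t by (simp_all add: C1_with_deriv_def)
  qed (use f_convex diff A_linear theta_pos t0_pos sigma_nonneg sol(1-3) eps_nonneg beta_nonneg
      cond_beta cond_gamma cond_theta \<open>A xhat = b\<close> min K c(1) c' lim_infinite xhat in auto)
  show ?thesis
  proof (intro conjI impI)
    show "Liminf at_top (\<lambda>t. ereal (norm (x t - xhat))) = 0"
      by (intro Liminf_eq_0I frequently_near) auto
    assume "\<exists>T\<ge>t0. (\<forall>t\<ge>T. x t \<in> ball 0 (norm xhat)) \<or> (\<forall>t\<ge>T. x t \<in> - ball 0 (norm xhat))"
    then obtain T where T: "T \<ge> t0"
      "(\<forall>t\<ge>T. norm (x t) < norm xhat) \<or> (\<forall>t\<ge>T. norm (x t) \<ge> norm xhat)"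
      by (auto simp: not_less)
    from T(2) show "((\<lambda>t. norm (x t - xhat)) \<longlongrightarrow> 0) at_top"
    proof
      assume "\<forall>t\<ge>T. norm (x t) < norm xhat"
      then have "\<forall>\<^sub>F t in at_top. norm (x t) \<le> norm xhat"
        unfolding eventually_at_top_linorder by (auto intro: less_imp_le)
      then show ?thesis by (rule tendsto_if_inside)
    qed (use tendsto_if_outside T(1) in auto)
  qed
qed

end
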